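(* For every nonnegative integer $n$, $$p_\nu(6250n+5208)\equiv 0 \pmod{125}.$$
   Context: The numbers $p_\nu(n)$ are defined by the generating function $\sum_{n=0}^\infty p_\nu(n)q^n=\nu(-q)=\sum_{n=0}^\infty \frac{q^{n(n+1)}}{(q;q^2)_{n+1}}$, where $\nu(q):=\sum_{n=0}^\infty \frac{q^{n(n+1)}}{(-q;q^2)_{n+1}}$ is the third order mock theta function and $(a;q)_n:=\prod_{k=0}^{n-1}(1-aq^k)$. Combinatorially, $p_\nu(n)$ is the number of partitions of $n$ into distinct nonnegative parts (so $0$ is allowed as a part, at most once) in which every odd part is less than twice the smallest part; for example $p_\nu(8)=5$. *)

theory Defs
  imports "HOL-Computational_Algebra.Formal_Power_Series" "HOL-Number_Theory.Cong"
begin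

text \<open>\<open>qpoch a q n\<close> is the finite $q$-shifted factorial $(a;q)_n$.\<close>

definition qpoch :: "'a::comm_ring_1 \<Rightarrow> 'a \<Rightarrow> nat \<Rightarrow> 'a" where
  "qpoch a q n = (\<Prod>k<n. 1 - a * q ^ k)"

text \<open>
  Division on \<open>'a fps\<close> needs a division operation on the coefficients, which \<open>int\<close> does not
  have. Every denominator below has constant term 1, so it is a unit of the ring of integer
  power series, and the following is its inverse there (see \<open>recip_mult\<close> and \<open>qpoch_recip\<close>).
\<close>

definition recip :: "int fps \<Rightarrow> int fps" where
  "recip f = fps_right_inverse f 1"

lemma recip_mult:
  assumes "fps_nth f 0 = 1"
  shows "f * recip f = 1"
  unfolding recip_def by (rule fps_right_inverse) (use assms in simp)

text \<open>
  The third order mock theta function, as a formal series evaluated at a power series \<open>q\<close> with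
  zero constant term. The infinite sum is taken in the \<open>X\<close>-adic topology on power series;
  \<open>nu_sums\<close> shows that it converges.
\<close>

definition nu :: "int fps \<Rightarrow> int fps" where
  "nu q = (\<Sum>n. q ^ (n * (n + 1)) * recip (qpoch (- q) (q\<^sup>2) (n + 1)))"

definition p_nu :: "nat \<Rightarrow> int" where
  "p_nu n = fps_nth (nu (- fps_X)) n"

lemma qpoch_nth_0:
  assumes "fps_nth (a :: int fps) 0 = 0"
  shows "fps_nth (qpoch a q n) 0 = 1"
  unfolding qpoch_def by (induction n) (simp_all add: assms)

lemma qpoch_recip:
  assumes "fps_nth a 0 = 0"
  shows "qpoch a q n * recip (qpoch a q n) = 1"
  by (intro recip_mult qpoch_nth_0 assms)

lemma fps_power_mult_nth_eq_0:
  assumes "fps_nth (q :: int fps) 0 = 0" "k < m"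
  shows "fps_nth (q ^ m * g) k = 0"
  unfolding fps_mult_nth using assms
  by (intro sum.neutral ballI) (auto simp: startsby_zero_power_prefix)

lemma nu_sums:
  assumes "fps_nth q 0 = 0"
  shows "(\<lambda>n. q ^ (n * (n + 1)) * recip (qpoch (- q) (q\<^sup>2) (n + 1))) sums nu q"
proof -
  define f where "f = (\<lambda>n. q ^ (n * (n + 1)) * recip (qpoch (- q) (q\<^sup>2) (n + 1)))"
  define S where "S = Abs_fps (\<lambda>k. \<Sum>n\<le>k. fps_nth (f n) k)"
  have "f sums S"
    unfolding sums_def
  proof (rule tendsto_fpsI)
    fix k
    show "\<forall>\<^sub>F N in sequentially. fps_nth (\<Sum>n<N. f n) k = fps_nth S k"
      unfolding eventually_sequentially
    proof (intro exI allI impI)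
      fix N assume "k + 1 \<le> N"
      then have "(\<Sum>n\<le>k. fps_nth (f n) k) = (\<Sum>n<N. fps_nth (f n) k)"
        unfolding f_def
        by (intro sum.mono_neutral_left ballI fps_power_mult_nth_eq_0 assms) auto
      then show "fps_nth (\<Sum>n<N. f n) k = fps_nth S k"
        by (simp add: S_def fps_sum_nth)
    qed
  qed
  then have "f sums (\<Sum>n. f n)"
    by (simp add: sums_iff)
  then show ?thesis
    by (simp add: f_def nu_def)
qed

lemma nu_minus_X:
  "nu (- fps_X) = (\<Sum>n. fps_X ^ (n * (n + 1)) * recip (qpoch fps_X (fps_X\<^sup>2) (n + 1)))"
  unfolding nu_def by (simp add: uminus_power_if)

end

theory Submission
  imports Defs "HOL-Computational_Algebra.Formal_Laurent_Series"
begin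

text \<open>
  Let $E(q) = (q;q)_\infty$ and $\varphi = \sum_n (-1)^n q^{n^2} = E(q)^2/E(q^2)$. The proof has two
  parts: a closed form for the even coefficients of $\nu(-q)$, and a 5-adic analysis of this closed
  form.

  In the bilateral series $\sum_{n \in \mathbb{Z}} q^{n(n+1)}/(-q;q^2)_{n+1}$ the terms of non-negative index
  add up to $\nu(q)$, and those of negative index, rewritten without negative exponents, add up to
  $\nu(-q)$ (\<open>nu_minus_X_eq\<close>). Replacing $n+1$ by $n+m+1$ in the denominators multiplies the
  bilateral sum by $(q;q^2)_m$, and for $m \to \infty$ it becomes a theta series divided by
  $(-q;q^2)_\infty$. With the triple product this yields
  $\nu(q)+\nu(-q) = 2E(q^4)^3/E(q^2)^2$ (\<open>nu_even_part\<close>). Hence the numbers $p_\nu(2n)$ are the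
  coefficients of $E(q^2)^3/E(q)^2 = E(q^2)^2 \varphi^{-1}$ (\<open>p_nu_even\<close>).

  Since $6250n+5208 = 2(3125n+2604)$ and 2604 has the base 5 digits 4, 0, 4, 0, 4, the claim is
  that five successive extractions of the exponents congruent to 4, 0, 4, 0, 4 modulo 5 turn
  $E(q^2)^2 \varphi^{-1}$ into a multiple of 125 (\<open>five_sections\<close>). For this, $\varphi$ and $E$ are split
  according to the exponents modulo 5. The splitting of $E(q)^2 = \varphi E(q^2)$ by residues and the
  identity \<open>phi_squared\<close> for $\varphi(q^5)^2$ determine all algebraic relations between the parts
  (\<open>theta_relations\<close>). In particular $\varphi$ satisfies an equation of degree 5 whose
  coefficients are polynomials in $\varphi(q^5)$ and $\varphi(q^{25})$ (\<open>phi_quintic\<close>). Extracting a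
  residue class from $\varphi^m$ or $E(q^2)^2\varphi^m$ is linear over the series in $q^5$, so the equation
  gives a recurrence in $m$ of order 5 for the results. The values for $m = 0, \dots, 4$ come from
  the dissections, and running the recurrence backwards gives those for negative $m$ as explicit
  polynomials in $\varphi(q^5)$ and $\varphi^{-1}$, in the second case times $E(q^{10})^2$. The powers of 5
  are visible in their coefficients.
\<close>

section \<open>Infinite products of integer power series\<close>

lemma fps_X_power_dvd_iff:
  "fps_X ^ k dvd (F :: int fps) \<longleftrightarrow> (\<forall>i<k. fps_nth F i = 0)"
proof
  assume "fps_X ^ k dvd F"
  then obtain G where "F = fps_X ^ k * G" by (elim dvdE)
  then show "\<forall>i<k. fps_nth F i = 0" by (simp add: fps_X_power_mult_nth)
next
  assume *: "\<forall>i<k. fps_nth F i = 0"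
  have "F = fps_X ^ k * fps_shift k F"
    by (rule fps_ext) (use * in \<open>auto simp: fps_X_power_mult_nth\<close>)
  then show "fps_X ^ k dvd F" by (metis dvd_triv_left)
qed

text \<open>
  Convergence of power series is handled by congruences modulo powers of \<open>fps_X\<close>: two series
  coincide once they agree modulo every such power, and congruences are compatible with
  products (\<open>dvd_diff_mult\<close>).
\<close>

lemma fps_eq_if_dvd_all:
  fixes F G :: "int fps"
  assumes "\<And>k. fps_X ^ k dvd F - G"
  shows "F = G"
  by (rule fps_ext) (use assms in \<open>auto simp: fps_X_power_dvd_iff\<close>)

lemma dvd_diff_mult:
  fixes m :: "'a :: comm_ring_1"
  assumes "m dvd F - F'" "m dvd G - G'"
  shows "m dvd F * G - F' * G'"
proof -
  have "F * G - F' * G' = (F - F') * G + F' * (G - G')" by (simp add: algebra_simps)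
  then show ?thesis using assms by simp
qed

lemma fps_X_dvd_if_nth_0:
  "fps_nth (q :: int fps) 0 = 0 \<Longrightarrow> fps_X dvd q"
  using fps_X_power_dvd_iff[of 1 q] by simp

lemma fps_X_power_dvd_power:
  assumes "fps_nth (q :: int fps) 0 = 0" "k \<le> n"
  shows "fps_X ^ k dvd q ^ n"
  using dvd_power_same[OF fps_X_dvd_if_nth_0[OF assms(1)], of n] assms(2)
  by (meson dvd_trans le_imp_power_dvd)

text \<open>
  The infinite product $(a;q)_\infty$ for \<open>q\<close> without constant term. The \<open>k\<close>-th coefficient of
  the finite products is stable once \<open>k + 1\<close> factors are present.
\<close>

definition qinf :: "int fps \<Rightarrow> int fps \<Rightarrow> int fps" where
  "qinf a q = Abs_fps (\<lambda>k. fps_nth (qpoch a q (Suc k)) k)"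

lemma qpoch_zero [simp]: "qpoch a q 0 = 1"
  by (simp add: qpoch_def)

lemma qpoch_Suc: "qpoch a q (Suc n) = qpoch a q n * (1 - a * q ^ n)"
  by (simp add: qpoch_def)

lemma qpoch_Suc_shift: "qpoch a q (Suc n) = (1 - a) * qpoch (a * q) q n"
  unfolding qpoch_def by (subst prod.lessThan_Suc_shift) (simp add: mult.assoc)

text \<open>
  A factor \<open>1 - a * q ^ m\<close> with \<open>m \<ge> n\<close> is congruent to 1 modulo \<open>fps_X ^ n\<close>.
\<close>

lemma qpoch_trunc:
  fixes a q :: "int fps"
  assumes "fps_nth q 0 = 0" "n \<le> N"
  shows "fps_X ^ n dvd qpoch a q N - qpoch a q n"
  using assms(2)
proof (induction N rule: dec_induct)
  case (step m)
  have "qpoch a q (Suc m) - qpoch a q n = (qpoch a q m - qpoch a q n) - qpoch a q m * a * q ^ m"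
    by (simp add: qpoch_Suc algebra_simps)
  moreover have "fps_X ^ n dvd q ^ m"
    using assms(1) step by (intro fps_X_power_dvd_power) auto
  ultimately show ?case using step by (metis dvd_diff dvd_mult)
qed simp

lemma qinf_trunc:
  assumes "fps_nth q 0 = 0"
  shows "fps_X ^ n dvd qinf a q - qpoch a q n"
  unfolding fps_X_power_dvd_iff
proof (intro allI impI)
  fix i assume "i < n"
  then have "fps_X ^ Suc i dvd qpoch a q n - qpoch a q (Suc i)"
    by (intro qpoch_trunc assms) auto
  then show "fps_nth (qinf a q - qpoch a q n) i = 0"
    unfolding fps_X_power_dvd_iff by (simp add: qinf_def)
qed

lemma qinf_trunc':
  assumes "fps_nth q 0 = 0" "n \<le> N"
  shows "fps_X ^ n dvd qinf a q - qpoch a q N"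
  using qinf_trunc[OF assms(1), of N a] assms(2) by (meson dvd_trans le_imp_power_dvd)

lemma qpoch_even_odd: "qpoch a q (2 * n) = qpoch a (q^2) n * qpoch (a * q) (q^2) n"
  by (induction n) (simp_all add: qpoch_Suc power_mult [symmetric] algebra_simps)

lemma qpoch_mult_minus: "qpoch a q n * qpoch (- a) q n = qpoch (a^2) (q^2) n"
  unfolding qpoch_def prod.distrib [symmetric]
  by (intro prod.cong) (auto simp: algebra_simps power2_eq_square power_mult_distrib)

lemma qpoch_three: 
  "qpoch a q (3 * n) = qpoch a (q^3) n * qpoch (a * q) (q^3) n * qpoch (a * q^2) (q^3) n"
proof (induction n)
  case (Suc n)
  have "qpoch a q (3 * Suc n) = qpoch a q (Suc (Suc (Suc (3 * n))))"
    by (simp add: eval_nat_numeral)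
  then show ?case using Suc
    by (simp add: qpoch_Suc power_mult [symmetric] power_add eval_nat_numeral algebra_simps)
qed simp

lemma qinf_even_odd:
  assumes "fps_nth q 0 = 0"
  shows "qinf a q = qinf a (q^2) * qinf (a * q) (q^2)"
proof (rule fps_eq_if_dvd_all)
  fix k
  let ?P = "qpoch a (q^2) k * qpoch (a * q) (q^2) k"
  have 1: "fps_X ^ k dvd qinf a q - ?P"
    unfolding qpoch_even_odd[symmetric] by (intro qinf_trunc' assms) auto
  have 2: "fps_X ^ k dvd qinf a (q^2) * qinf (a * q) (q^2) - ?P"
    using assms by (intro dvd_diff_mult qinf_trunc) (simp_all add: power2_eq_square)
  show "fps_X ^ k dvd qinf a q - qinf a (q^2) * qinf (a * q) (q^2)"
    using dvd_diff[OF 1 2] by simp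
qed

lemma qinf_three:
  assumes "fps_nth q 0 = 0"
  shows "qinf a q = qinf a (q^3) * qinf (a * q) (q^3) * qinf (a * q^2) (q^3)"
proof (rule fps_eq_if_dvd_all)
  fix k
  let ?P = "qpoch a (q^3) k * qpoch (a * q) (q^3) k * qpoch (a * q^2) (q^3) k"
  have 1: "fps_X ^ k dvd qinf a q - ?P"
    unfolding qpoch_three[symmetric] by (intro qinf_trunc' assms) auto
  have 2: "fps_X ^ k dvd qinf a (q^3) * qinf (a * q) (q^3) * qinf (a * q^2) (q^3) - ?P"
    using assms by (intro dvd_diff_mult qinf_trunc) (simp_all add: power3_eq_cube)
  show "fps_X ^ k dvd qinf a q - qinf a (q^3) * qinf (a * q) (q^3) * qinf (a * q^2) (q^3)"
    using dvd_diff[OF 1 2] by simp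
qed

lemma qinf_mult_minus:
  assumes "fps_nth q 0 = 0"
  shows "qinf a q * qinf (- a) q = qinf (a^2) (q^2)"
proof (rule fps_eq_if_dvd_all)
  fix k
  have 1: "fps_X ^ k dvd qinf (a^2) (q^2) - qpoch (a^2) (q^2) k"
    using assms by (intro qinf_trunc) (simp_all add: power2_eq_square)
  have 2: "fps_X ^ k dvd qinf a q * qinf (- a) q - qpoch a q k * qpoch (- a) q k"
    using assms by (intro dvd_diff_mult qinf_trunc)
  show "fps_X ^ k dvd qinf a q * qinf (- a) q - qinf (a^2) (q^2)"
    using dvd_diff[OF 2 1[folded qpoch_mult_minus]] by simp
qed

lemma qinf_shift:
  assumes "fps_nth q 0 = 0"
  shows "qinf a q = (1 - a) * qinf (a * q) q"
proof (rule fps_eq_if_dvd_all)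
  fix k
  have 1: "fps_X ^ k dvd qinf a q - qpoch a q (Suc k)"
    using assms by (intro qinf_trunc') auto
  have 2: "fps_X ^ k dvd (1 - a) * qinf (a * q) q - (1 - a) * qpoch (a * q) q k"
    using assms by (intro dvd_diff_mult qinf_trunc) auto
  show "fps_X ^ k dvd qinf a q - (1 - a) * qinf (a * q) q"
    using dvd_diff[OF 1 2[folded qpoch_Suc_shift]] by simp
qed

lemma qinf_nth_0:
  assumes "fps_nth a 0 = 0"
  shows "fps_nth (qinf a q) 0 = 1"
  by (simp add: qinf_def qpoch_nth_0 assms)

section \<open>The Jacobi triple product\<close>

text \<open>
  The Gaussian binomial coefficients, by the \<open>q\<close>-Pascal rule, which makes sense over every ring.
\<close>

fun gauss_binom :: "'a::comm_ring_1 \<Rightarrow> nat \<Rightarrow> nat \<Rightarrow> 'a" where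
  "gauss_binom q n 0 = 1"
| "gauss_binom q 0 (Suc r) = 0"
| "gauss_binom q (Suc n) (Suc r) = gauss_binom q n r + q ^ Suc r * gauss_binom q n (Suc r)"

lemma gauss_binom_eq_0: "n < r \<Longrightarrow> gauss_binom q n r = 0"
  by (induction q n r rule: gauss_binom.induct) auto

text \<open>
  The mirror image of the defining rule. Both rules are needed: one moves the upper end of the
  finite triple product, the other the lower end.
\<close>

lemma gauss_binom_Suc_Suc':
  fixes q :: "'a :: comm_ring_1"
  shows "r \<le> n \<Longrightarrow> gauss_binom q (Suc n) (Suc r) = gauss_binom q n (Suc r) + q ^ (n - r) * gauss_binom q n r"
proof (induction n arbitrary: r)
  case (Suc n)
  show ?case
  proof (cases r)
    case 0
    then show ?thesis using Suc.IH[of 0] by (simp add: algebra_simps)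
  next
    case (Suc s)
    have s: "s \<le> n" using Suc Suc.prems by simp
    show ?thesis
    proof (cases "r = Suc n")
      case True
      then show ?thesis by (simp add: gauss_binom_eq_0)
    next
      case False
      then have r: "r \<le> n" using Suc.prems by simp
      then have e: "q ^ Suc r * q ^ (n - r) = q ^ (n - s) * q ^ r"
        unfolding power_add [symmetric] using Suc by (intro arg_cong[where f = "power q"]) simp
      have "gauss_binom q (Suc (Suc n)) (Suc r) =
          gauss_binom q (Suc n) (Suc s) + q ^ Suc r * gauss_binom q (Suc n) (Suc r)"
        using Suc by simp
      also have "\<dots> = (gauss_binom q n r + q ^ (n - s) * gauss_binom q n s) +
          q ^ Suc r * (gauss_binom q n (Suc r) + q ^ (n - r) * gauss_binom q n r)"
        using Suc.IH[OF s] Suc.IH[OF r] Suc by simp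
      also have "\<dots> = (gauss_binom q n r + q ^ Suc r * gauss_binom q n (Suc r)) +
          q ^ (n - s) * (gauss_binom q n s + q ^ r * gauss_binom q n r)"
      proof -
        have "a + w * b + u * (c + v * a) = (a + u * c) + w * (b + z * a)"
          if "u * v = w * z" for a b c u v w z :: 'a
        proof -
          have "u * (v * a) = w * (z * a)" using that by (simp add: mult.assoc [symmetric])
          then show ?thesis unfolding distrib_left by (simp add: add_ac)
        qed
        from this[OF e] show ?thesis .
      qed
      also have "\<dots> = gauss_binom q (Suc n) (Suc r) + q ^ (Suc n - r) * gauss_binom q (Suc n) r"
        using Suc by simp
      finally show ?thesis .
    qed
  qed
qed simp

text \<open>
  The quotient formula, written without division.
\<close>

lemma gauss_binom_qpoch:
  fixes q :: "'a :: comm_ring_1"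
  shows "r \<le> n \<Longrightarrow> gauss_binom q n r * qpoch q q r * qpoch q q (n - r) = qpoch q q n"
proof (induction n arbitrary: r)
  case (Suc n)
  show ?case
  proof (cases r)
    case (Suc s)
    have s: "s \<le> n" using Suc Suc.prems by simp
    have 1: "gauss_binom q n s * qpoch q q s * qpoch q q (n - s) = qpoch q q n"
      by (rule Suc.IH[OF s])
    have 2: "gauss_binom q n r * qpoch q q r * qpoch q q (n - s) = qpoch q q n * (1 - q * q ^ (n - r))"
    if "r \<le> n"
    proof -
      have "n - s = Suc (n - r)" using that Suc by simp
      then show ?thesis using Suc.IH[OF that] by (simp add: qpoch_Suc mult.assoc [symmetric])
    qed
    show ?thesis
    proof (cases "r \<le> n")
      case True
      have e: "q ^ r * (q * q ^ (n - r)) = q * q ^ n"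
        using True by (metis le_add_diff_inverse mult.left_commute power_add)
      have alg: "(g1 + d * g2) * p' * m = P * (1 - e)"
        if "g1 * p * m = P" "g2 * p' * m = P * (1 - c)" "p' = p * (1 - d)" "d * c = e"
        for g1 g2 p p' m P c d e :: 'a
      proof -
        have "g1 * p' * m = g1 * p * m * (1 - d)" by (simp add: that(3) mult_ac)
        then have "(g1 + d * g2) * p' * m = g1 * p * m * (1 - d) + d * (g2 * p' * m)"
          by (simp add: distrib_right mult.assoc)
        also have "\<dots> = P * (1 - d * c)" unfolding that(1,2) by (simp add: algebra_simps)
        finally show ?thesis using that by simp
      qed
      have "qpoch q q r = qpoch q q s * (1 - q ^ r)" using Suc by (simp add: qpoch_Suc)
      from alg[OF 1 2[OF True] this e] show ?thesis
        using Suc by (simp add: qpoch_Suc)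
    next
      case False
      then have "r = Suc n" "s = n" using Suc.prems Suc by auto
      then show ?thesis using 1 by (simp add: qpoch_Suc gauss_binom_eq_0 mult.assoc [symmetric])
    qed
  qed simp
qed simp

text \<open>
  The term $x^j q^{j(j-1)/2}$ of the theta series for an arbitrary integer \<open>j\<close>. With \<open>x * y = q\<close>
  its value for negative \<open>j\<close> can be written with non-negative exponents only, as a power of \<open>y\<close>.
\<close>

definition theta_term :: "'a::comm_ring_1 \<Rightarrow> 'a \<Rightarrow> 'a \<Rightarrow> int \<Rightarrow> 'a" where
  "theta_term x y q j =
    (if j \<ge> 0 then x ^ nat j * q ^ (nat j choose 2) else y ^ nat (- j) * q ^ (nat (- j) choose 2))"

lemma Suc_choose_2: "Suc n choose 2 = (n choose 2) + n"
  by (simp add: numeral_2_eq_2)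

lemma theta_term_swap: "theta_term y x q (- j) = theta_term x y q j"
  by (cases "j = 0") (auto simp: theta_term_def)

lemma theta_term_up:
  assumes "x * y = q" "j \<le> int n"
  shows "x * q ^ n * theta_term x y q j = q ^ nat (int n - j) * theta_term x y q (j + 1)"
proof (cases "j \<ge> 0")
  case True
  then obtain i where i: "j = int i" by (metis nonneg_int_cases)
  then have "q ^ n = q ^ (n - i) * q ^ i"
    using assms(2) by (simp add: power_add [symmetric])
  moreover have "nat (int i + 1) = Suc i" "nat (int n - int i) = n - i" by simp_all
  ultimately show ?thesis
    using i by (simp add: theta_term_def Suc_choose_2 power_add algebra_simps)
next
  case False
  then obtain i where i: "j = - int (Suc i)"
    by (metis int_cases not_less of_nat_0_le_iff)
  have e: "nat (int n - j) = n + Suc i" "nat (-j) = Suc i" "j < 0" using i by simp_all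
  then have "x * q ^ n * theta_term x y q j =
      (x * y) * q ^ n * y ^ i * q ^ (i choose 2) * q ^ i"
    by (simp add: theta_term_def Suc_choose_2 power_add algebra_simps)
  also have "\<dots> = q ^ nat (int n - j) * (y ^ i * q ^ (i choose 2))"
    unfolding e by (simp add: assms power_add algebra_simps)
  also have "y ^ i * q ^ (i choose 2) = theta_term x y q (j + 1)"
    using i by (cases "i = 0") (auto simp: theta_term_def binomial_eq_0)
  finally show ?thesis .
qed

lemma theta_term_down:
  assumes "x * y = q" "- int n \<le> j"
  shows "y * q ^ n * theta_term x y q j = q ^ nat (int n + j) * theta_term x y q (j - 1)"
proof -
  have "y * q ^ n * theta_term y x q (- j) = q ^ nat (int n - - j) * theta_term y x q (- j + 1)"
    using assms by (intro theta_term_up) (auto simp: mult.commute)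
  also have "- j + 1 = - (j - 1)" by simp
  finally show ?thesis unfolding theta_term_swap by simp
qed

text \<open>
  The \<open>q\<close>-binomial theorem with \<open>n\<close> factors of one kind and \<open>m\<close> of the other, so that each
  induction step adds a single factor and amounts to one application of a \<open>q\<close>-Pascal rule.
\<close>

lemma asymmetric_triple_product:
  assumes "x * y = q"
  shows "qpoch (- x) q n * qpoch (- y) q m =
    (\<Sum>r\<le>n + m. gauss_binom q (n + m) r * theta_term x y q (int r - int m))"
proof (induction m)
  case 0
  show ?case
  proof (induction n)
    case 0
    then show ?case by (simp add: theta_term_def binomial_eq_0)
  next
    case (Suc n)
    let ?t = "\<lambda>r. theta_term x y q (int r)"
    have "qpoch (- x) q (Suc n) = (\<Sum>r\<le>n. gauss_binom q n r * ?t r) * (1 + x * q ^ n)"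
      using Suc by (simp add: qpoch_Suc)
    also have "\<dots> = (\<Sum>r\<le>n. gauss_binom q n r * ?t r) +
        (\<Sum>r\<le>n. q ^ (n - r) * gauss_binom q n r * ?t (Suc r))"
    proof -
      have "gauss_binom q n r * ?t r * (x * q ^ n) = q ^ (n - r) * gauss_binom q n r * ?t (Suc r)"
        if "r \<le> n" for r
        using theta_term_up[OF assms, of "int r" n] that
        by (simp add: algebra_simps nat_diff_distrib)
      then show ?thesis by (simp add: distrib_left sum_distrib_right)
    qed
    also have "(\<Sum>r\<le>n. gauss_binom q n r * ?t r) =
        ?t 0 + (\<Sum>r\<le>n. gauss_binom q n (Suc r) * ?t (Suc r))"
    proof -
      have "(\<Sum>r\<le>n. gauss_binom q n r * ?t r) = (\<Sum>r\<le>Suc n. gauss_binom q n r * ?t r)"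
        by (simp add: gauss_binom_eq_0)
      also have "\<dots> = ?t 0 + (\<Sum>r\<le>n. gauss_binom q n (Suc r) * ?t (Suc r))"
        by (subst sum.atMost_Suc_shift) simp
      finally show ?thesis .
    qed
    also have "?t 0 + (\<Sum>r\<le>n. gauss_binom q n (Suc r) * ?t (Suc r)) +
        (\<Sum>r\<le>n. q ^ (n - r) * gauss_binom q n r * ?t (Suc r)) =
        ?t 0 + (\<Sum>r\<le>n. gauss_binom q (Suc n) (Suc r) * ?t (Suc r))"
      by (simp add: gauss_binom_Suc_Suc' sum.distrib algebra_simps
          del: gauss_binom.simps(3) of_nat_Suc)
    also have "\<dots> = (\<Sum>r\<le>Suc n. gauss_binom q (Suc n) r * ?t r)"
      by (subst sum.atMost_Suc_shift) simp
    finally show ?case by simp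
  qed
next
  case (Suc m)
  let ?N = "n + m"
  let ?t = "\<lambda>r. theta_term x y q (int r - int m)"
  let ?t' = "\<lambda>r. theta_term x y q (int r - int (Suc m))"
  have t: "?t r = ?t' (Suc r)" for r by simp
  have "qpoch (- x) q n * qpoch (- y) q (Suc m) =
      (\<Sum>r\<le>?N. gauss_binom q ?N r * ?t r) * (1 + y * q ^ m)"
    using Suc by (simp add: qpoch_Suc mult.assoc [symmetric])
  also have "\<dots> = (\<Sum>r\<le>?N. gauss_binom q ?N r * ?t r) +
      (\<Sum>r\<le>?N. q ^ r * gauss_binom q ?N r * ?t' r)"
  proof -
    have "gauss_binom q ?N r * ?t r * (y * q ^ m) = q ^ r * gauss_binom q ?N r * ?t' r" for r
    proof -
      have "gauss_binom q ?N r * ?t r * (y * q ^ m) = gauss_binom q ?N r * (y * q ^ m * ?t r)"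
        by (simp only: mult_ac)
      also have "y * q ^ m * ?t r = q ^ r * ?t' r"
        using theta_term_down[OF assms, of m "int r - int m"] by (simp add: algebra_simps)
      finally show ?thesis by (simp only: mult_ac)
    qed
    then show ?thesis by (simp add: distrib_left sum_distrib_right)
  qed
  also have "(\<Sum>r\<le>?N. q ^ r * gauss_binom q ?N r * ?t' r) =
      ?t' 0 + (\<Sum>r\<le>?N. q ^ Suc r * gauss_binom q ?N (Suc r) * ?t' (Suc r))"
  proof -
    have "(\<Sum>r\<le>?N. q ^ r * gauss_binom q ?N r * ?t' r) =
        (\<Sum>r\<le>Suc ?N. q ^ r * gauss_binom q ?N r * ?t' r)"
      by (simp add: gauss_binom_eq_0)
    also have "\<dots> = ?t' 0 + (\<Sum>r\<le>?N. q ^ Suc r * gauss_binom q ?N (Suc r) * ?t' (Suc r))"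
      by (subst sum.atMost_Suc_shift) simp
    finally show ?thesis .
  qed
  also have "(\<Sum>r\<le>?N. gauss_binom q ?N r * ?t r) +
      (?t' 0 + (\<Sum>r\<le>?N. q ^ Suc r * gauss_binom q ?N (Suc r) * ?t' (Suc r))) =
      ?t' 0 + (\<Sum>r\<le>?N. gauss_binom q (Suc ?N) (Suc r) * ?t' (Suc r))"
    unfolding t by (simp add: sum.distrib algebra_simps)
  also have "\<dots> = (\<Sum>r\<le>Suc ?N. gauss_binom q (Suc ?N) r * ?t' r)"
    by (subst sum.atMost_Suc_shift) simp
  finally show ?case by simp
qed

lemma finite_triple_product:
  assumes "x * y = q"
  shows "qpoch (- x) q n * qpoch (- y) q n =
    (\<Sum>j\<in>{- int n..int n}. gauss_binom q (2 * n) (nat (j + int n)) * theta_term x y q j)"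
  unfolding asymmetric_triple_product[OF assms] mult_2
  by (rule sum.reindex_bij_witness[of _ "\<lambda>j. nat (j + int n)" "\<lambda>r. int r - int n"]) auto

text \<open>
  As $n$ grows with both $r$ and $n - r$ large, $\binom{n}{r}_q$ tends to $1/(q;q)_\infty$.
\<close>

lemma gauss_binom_limit:
  assumes "fps_nth q 0 = 0" "k \<le> r" "k + r \<le> n"
  shows "fps_X ^ k dvd qinf q q * gauss_binom q n r - 1"
proof -
  let ?P = "qinf q q" and ?R = "recip (qinf q q)"
  have unit: "?P * ?R = 1" by (intro recip_mult qinf_nth_0 assms)
  have T: "fps_X ^ k dvd ?P - qpoch q q N" if "k \<le> N" for N
    by (rule qinf_trunc'[OF assms(1) that])
  have "fps_X ^ k dvd gauss_binom q n r * ?P * ?P - gauss_binom q n r * qpoch q q r * qpoch q q (n - r)"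
    by (intro dvd_diff_mult T) (use assms in simp_all)
  then have "fps_X ^ k dvd gauss_binom q n r * ?P * ?P - qpoch q q n"
    using assms by (simp add: gauss_binom_qpoch)
  moreover have "fps_X ^ k dvd ?P - qpoch q q n" using assms by (intro T) simp
  ultimately have "fps_X ^ k dvd
      (gauss_binom q n r * ?P * ?P - qpoch q q n) - (?P - qpoch q q n)"
    by (rule dvd_diff)
  then have "fps_X ^ k dvd gauss_binom q n r * ?P * ?P - ?P" by simp
  then have "fps_X ^ k dvd ?R * (gauss_binom q n r * ?P * ?P - ?P)" by simp
  also have "?R * (gauss_binom q n r * ?P * ?P - ?P) = (?P * ?R) * (?P * gauss_binom q n r) - ?P * ?R"
    by (simp add: algebra_simps)
  also have "\<dots> = ?P * gauss_binom q n r - 1"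
    by (simp add: unit)
  finally show ?thesis .
qed

lemma theta_term_order:
  fixes x y q :: "int fps"
  assumes "fps_nth q 0 = 0" "int k < \<bar>j\<bar>"
  shows "fps_X ^ k dvd theta_term x y q j"
proof -
  have c: "k \<le> (m choose 2)" if "k < m" for m
    using that by (induction m) (auto simp: Suc_choose_2 binomial_eq_0 numeral_2_eq_2 less_Suc_eq)
  show ?thesis
  proof (cases "j \<ge> 0")
    case True
    then have "k < nat j" using assms by simp
    then show ?thesis
      using True fps_X_power_dvd_power[OF assms(1) c] by (simp add: theta_term_def)
  next
    case False
    then have "k < nat (- j)" using assms by simp
    then show ?thesis
      using False fps_X_power_dvd_power[OF assms(1) c] by (simp add: theta_term_def)
  qed
qed

text \<open>
  Jacobi's triple product, as a congruence. In the finite version of length \<open>2 * k\<close> the terms with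
  \<open>\<bar>j\<bar> \<le> k\<close> have coefficients close to their limit, and the other terms are divisible by \<open>fps_X ^ k\<close>
  themselves.
\<close>

theorem triple_product:
  assumes "x * y = q" "fps_nth q 0 = 0"
  shows "fps_X ^ k dvd qinf (- x) q * qinf (- y) q * qinf q q -
    (\<Sum>j\<in>{- int k..int k}. theta_term x y q j)"
proof -
  let ?n = "2 * k" and ?P = "qinf q q"
  let ?g = "\<lambda>j. gauss_binom q (2 * ?n) (nat (j + int ?n))"
  have 1: "fps_X ^ k dvd qinf (- x) q * qinf (- y) q * ?P - qpoch (- x) q ?n * qpoch (- y) q ?n * ?P"
    using assms by (intro dvd_diff_mult qinf_trunc') auto
  have "qpoch (- x) q ?n * qpoch (- y) q ?n * ?P - (\<Sum>j\<in>{- int k..int k}. theta_term x y q j)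
      = (\<Sum>j\<in>{- int ?n..int ?n}. (?P * ?g j - (if \<bar>j\<bar> \<le> int k then 1 else 0)) * theta_term x y q j)"
  proof -
    have "(\<Sum>j\<in>{- int k..int k}. theta_term x y q j) =
        (\<Sum>j\<in>{- int ?n..int ?n}. (if \<bar>j\<bar> \<le> int k then 1 else 0) * theta_term x y q j)"
      by (intro sum.mono_neutral_cong_left) auto
    then show ?thesis
      unfolding finite_triple_product[OF assms(1)] left_diff_distrib sum_subtractf
      by (simp add: sum_distrib_left sum_distrib_right mult_ac)
  qed
  also have "fps_X ^ k dvd \<dots>"
  proof (intro dvd_sum)
    fix j assume j: "j \<in> {- int ?n..int ?n}"
    show "fps_X ^ k dvd (?P * ?g j - (if \<bar>j\<bar> \<le> int k then 1 else 0)) * theta_term x y q j"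
    proof (cases "\<bar>j\<bar> \<le> int k")
      case True
      then have "fps_X ^ k dvd ?P * ?g j - 1"
        by (intro gauss_binom_limit assms) auto
      then show ?thesis using True by simp
    next
      case False
      then show ?thesis by (intro dvd_mult theta_term_order assms) simp
    qed
  qed
  finally have 2: "fps_X ^ k dvd qpoch (- x) q ?n * qpoch (- y) q ?n * ?P -
      (\<Sum>j\<in>{- int k..int k}. theta_term x y q j)" .
  show ?thesis using dvd_add[OF 1 2] by simp
qed

section \<open>Series indexed by arbitrary sets\<close>

text \<open>
  The series $\sum_{i \in I} c_i q^{e_i}$. It is meaningful when every exponent is attained only
  finitely often; sums over integers and over lattices then split, multiply and reindex freely.
\<close>

definition genfun :: "'i set \<Rightarrow> ('i \<Rightarrow> nat) \<Rightarrow> ('i \<Rightarrow> int) \<Rightarrow> int fps" where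
  "genfun I e c = Abs_fps (\<lambda>k. \<Sum>i\<in>{i\<in>I. e i = k}. c i)"

definition finite_fibres :: "'i set \<Rightarrow> ('i \<Rightarrow> nat) \<Rightarrow> bool" where
  "finite_fibres I e \<longleftrightarrow> (\<forall>k. finite {i\<in>I. e i = k})"

text \<open>
  The substitution of $q^m$ for $q$.
\<close>

definition dil :: "nat \<Rightarrow> int fps \<Rightarrow> int fps" where
  "dil m F = fps_compose F (fps_X ^ m)"

text \<open>
  All exponents that occur are congruent to \<open>r\<close> modulo 5.
\<close>

definition supp5 :: "nat \<Rightarrow> int fps \<Rightarrow> bool" where
  "supp5 r F \<longleftrightarrow> (\<forall>n. fps_nth F n \<noteq> 0 \<longrightarrow> n mod 5 = r)"

lemma dil_nth: "m > 0 \<Longrightarrow> fps_nth (dil m F) n = (if m dvd n then fps_nth F (n div m) else 0)"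
  by (simp add: dil_def fps_nth_compose_X_power)

lemma dil_add: "dil m (F + G) = dil m F + dil m G"
  by (simp add: dil_def fps_compose_add_distrib)

lemma dil_diff: "dil m (F - G) = dil m F - dil m G"
  by (simp add: dil_def fps_compose_sub_distrib)

lemma dil_uminus: "dil m (- F) = - dil m F"
  by (simp add: dil_def fps_compose_uminus)

lemma dil_mult: "m > 0 \<Longrightarrow> dil m (F * G) = dil m F * dil m G"
  by (simp add: dil_def fps_compose_mult_distrib)

lemma dil_power: "m > 0 \<Longrightarrow> dil m (F ^ k) = dil m F ^ k"
  by (simp add: dil_def fps_compose_power)

lemma dil_numeral: "dil m (numeral k) = numeral k"
  by (simp add: dil_def)

lemma dil_one: "dil m 1 = 1"
  by (simp add: dil_def)

lemma dil_X: "m > 0 \<Longrightarrow> dil m fps_X = fps_X ^ m"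
  by (simp add: dil_def)

lemma dil_dil: "m > 0 \<Longrightarrow> n > 0 \<Longrightarrow> dil m (dil n F) = dil (m * n) F"
  by (simp add: dil_def fps_compose_assoc [symmetric] fps_X_power_compose power_mult)

lemma genfun_cong:
  "(\<And>i. i \<in> I \<Longrightarrow> e i = e' i) \<Longrightarrow> (\<And>i. i \<in> I \<Longrightarrow> c i = c' i) \<Longrightarrow> genfun I e c = genfun I e' c'"
  unfolding genfun_def by (intro arg_cong[where f = Abs_fps] ext sum.cong) auto

lemma genfun_reindex:
  assumes "bij_betw h J I"
  shows "genfun I e c = genfun J (\<lambda>j. e (h j)) (\<lambda>j. c (h j))"
proof -
  have "bij_betw h {j\<in>J. e (h j) = k} {i\<in>I. e i = k}" for k
    using assms unfolding bij_betw_def by (auto simp: inj_on_def)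
  then show ?thesis
    unfolding genfun_def by (intro arg_cong[where f = Abs_fps] ext sum.reindex_bij_betw [symmetric])
qed

lemma finite_fibres_subset: "finite_fibres I e \<Longrightarrow> J \<subseteq> I \<Longrightarrow> finite_fibres J e"
  unfolding finite_fibres_def by (blast intro: finite_subset[rotated])

lemma genfun_UNION:
  assumes "finite_fibres I e" "finite R" "\<And>r. r \<in> R \<Longrightarrow> C r \<subseteq> I" "I = (\<Union>r\<in>R. C r)"
    and "\<And>r s. r \<in> R \<Longrightarrow> s \<in> R \<Longrightarrow> r \<noteq> s \<Longrightarrow> C r \<inter> C s = {}"
  shows "genfun I e c = (\<Sum>r\<in>R. genfun (C r) e c)"
proof (rule fps_ext)
  fix k
  have "{i\<in>I. e i = k} = (\<Union>r\<in>R. {i\<in>C r. e i = k})" using assms(4) by auto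
  then have "fps_nth (genfun I e c) k = (\<Sum>i\<in>(\<Union>r\<in>R. {i\<in>C r. e i = k}). c i)"
    by (simp add: genfun_def)
  also have "\<dots> = (\<Sum>r\<in>R. \<Sum>i\<in>{i\<in>C r. e i = k}. c i)"
  proof (rule sum.UNION_disjoint)
    show "\<forall>r\<in>R. finite {i\<in>C r. e i = k}"
      using finite_fibres_subset[OF assms(1)] assms(3) unfolding finite_fibres_def by blast
    show "\<forall>r\<in>R. \<forall>s\<in>R. r \<noteq> s \<longrightarrow> {i\<in>C r. e i = k} \<inter> {i\<in>C s. e i = k} = {}"
      using assms(5) by blast
  qed (rule assms)
  also have "\<dots> = fps_nth (\<Sum>r\<in>R. genfun (C r) e c) k"
    by (simp add: genfun_def fps_sum_nth)
  finally show "fps_nth (genfun I e c) k = fps_nth (\<Sum>r\<in>R. genfun (C r) e c) k" .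
qed

lemma genfun_times:
  assumes "finite_fibres I e" "finite_fibres J e'"
  shows "genfun I e c * genfun J e' c' = genfun (I \<times> J) (\<lambda>(i, j). e i + e' j) (\<lambda>(i, j). c i * c' j)"
proof (rule fps_ext)
  fix k
  let ?A = "\<lambda>m. {i\<in>I. e i = m}" and ?B = "\<lambda>m. {j\<in>J. e' j = m}"
  have fin: "finite (?A m)" "finite (?B m)" for m
    using assms by (auto simp: finite_fibres_def)
  have "fps_nth (genfun I e c * genfun J e' c') k =
      (\<Sum>m\<le>k. \<Sum>p\<in>?A m \<times> ?B (k - m). c (fst p) * c' (snd p))"
    by (simp add: fps_mult_nth genfun_def sum_product sum.cartesian_product atLeast0AtMost
        case_prod_unfold)
  also have "\<dots> = (\<Sum>p\<in>(\<Union>m\<in>{..k}. ?A m \<times> ?B (k - m)). c (fst p) * c' (snd p))"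
    by (rule sum.UNION_disjoint [symmetric]) (auto simp: fin)
  also have "(\<Union>m\<in>{..k}. ?A m \<times> ?B (k - m)) = {p \<in> I \<times> J. (case p of (i, j) \<Rightarrow> e i + e' j) = k}"
    by auto
  finally show "fps_nth (genfun I e c * genfun J e' c') k =
      fps_nth (genfun (I \<times> J) (\<lambda>(i, j). e i + e' j) (\<lambda>(i, j). c i * c' j)) k"
    by (simp add: genfun_def case_prod_unfold)
qed

lemma dil_genfun:
  assumes "m > 0"
  shows "dil m (genfun I e c) = genfun I (\<lambda>i. m * e i) c"
proof (rule fps_ext)
  fix n
  have "{i \<in> I. m * e i = n} = (if m dvd n then {i \<in> I. e i = n div m} else {})"
    using assms by auto
  then show "fps_nth (dil m (genfun I e c)) n = fps_nth (genfun I (\<lambda>i. m * e i) c) n"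
    using assms by (simp add: dil_nth genfun_def)
qed

lemma X_power_genfun: "fps_X ^ m * genfun I e c = genfun I (\<lambda>i. m + e i) c"
proof (rule fps_ext)
  fix n
  have "{i \<in> I. m + e i = n} = (if n < m then {} else {i \<in> I. e i = n - m})"
    by auto
  then show "fps_nth (fps_X ^ m * genfun I e c) n = fps_nth (genfun I (\<lambda>i. m + e i) c) n"
    by (simp add: fps_X_power_mult_nth genfun_def)
qed

lemma uminus_genfun: "- genfun I e c = genfun I e (\<lambda>i. - c i)"
  by (rule fps_ext) (simp add: genfun_def sum_negf)

lemma supp5_genfun: "(\<And>i. i \<in> I \<Longrightarrow> e i mod 5 = r) \<Longrightarrow> supp5 r (genfun I e c)"
  unfolding supp5_def genfun_def
proof (intro allI impI)
  fix n assume e: "\<And>i. i \<in> I \<Longrightarrow> e i mod 5 = r"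
    and "fps_nth (Abs_fps (\<lambda>k. \<Sum>i\<in>{i \<in> I. e i = k}. c i)) n \<noteq> 0"
  then have "(\<Sum>i\<in>{i \<in> I. e i = n}. c i) \<noteq> 0" by simp
  then have "{i \<in> I. e i = n} \<noteq> {}" by (metis sum.empty)
  then show "n mod 5 = r" using e by auto
qed

lemma supp5_0 [simp]: "supp5 r 0"
  by (simp add: supp5_def)

lemma supp5_add: "supp5 r F \<Longrightarrow> supp5 r G \<Longrightarrow> supp5 r (F + G)"
  unfolding supp5_def fps_add_nth by force

lemma supp5_uminus: "supp5 r F \<Longrightarrow> supp5 r (- F)"
  unfolding supp5_def by simp

lemma supp5_mult:
  assumes "supp5 r F" "supp5 s G" "(r + s) mod 5 = t"
  shows "supp5 t (F * G)"
  unfolding supp5_def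
proof (intro allI impI)
  fix n assume "fps_nth (F * G) n \<noteq> 0"
  then obtain i where "i \<in> {0..n}" "fps_nth F i * fps_nth G (n - i) \<noteq> 0"
    unfolding fps_mult_nth by (rule sum.not_neutral_contains_not_neutral)
  then have "i \<le> n" "fps_nth F i \<noteq> 0" "fps_nth G (n - i) \<noteq> 0" by auto
  then have "i mod 5 = r" "(n - i) mod 5 = s"
    using assms(1,2) unfolding supp5_def by blast+
  then have "(i + (n - i)) mod 5 = t" using assms(3) by (metis mod_add_eq)
  then show "n mod 5 = t" using \<open>i \<le> n\<close> by simp
qed

lemma supp5_numeral_mult: "supp5 r F \<Longrightarrow> supp5 r (numeral k * F)"
  unfolding supp5_def by (simp add: numeral_fps_const)

lemma supp5_dil:
  assumes "supp5 r F" "m > 0" "(m * r) mod 5 = t"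
  shows "supp5 t (dil m F)"
  using assms unfolding supp5_def by (auto simp: dil_nth elim!: dvdE) (metis mod_mult_right_eq)

lemma supp5_dil5: 
  assumes "m > 0" "5 dvd m"
  shows "supp5 0 (dil m F)"
  using assms unfolding supp5_def by (auto simp: dil_nth elim!: dvdE)

lemma supp5_X_power: "supp5 (m mod 5) (fps_X ^ m)"
  unfolding supp5_def by (simp add: fps_X_power_nth)

text \<open>
  A series determines its five parts, so an equation between dissected series can be read off
  residue by residue. This turns each product identity below into five algebraic relations.
\<close>

lemma supp5_unique:
  assumes "supp5 0 F0" "supp5 1 F1" "supp5 2 F2" "supp5 3 F3" "supp5 4 F4"
    and "supp5 0 G0" "supp5 1 G1" "supp5 2 G2" "supp5 3 G3" "supp5 4 G4"
    and eq: "F0 + F1 + F2 + F3 + F4 = G0 + G1 + G2 + G3 + G4"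
  shows "F0 = G0" "F1 = G1" "F2 = G2" "F3 = G3" "F4 = G4"
proof -
  have e: "fps_nth F0 n + fps_nth F1 n + fps_nth F2 n + fps_nth F3 n + fps_nth F4 n =
      fps_nth G0 n + fps_nth G1 n + fps_nth G2 n + fps_nth G3 n + fps_nth G4 n" for n
    using arg_cong[OF eq, of "\<lambda>F. fps_nth F n"] by simp
  have z: "n mod 5 = 0 \<or> fps_nth F0 n = 0 \<and> fps_nth G0 n = 0"
    "n mod 5 = 1 \<or> fps_nth F1 n = 0 \<and> fps_nth G1 n = 0"
    "n mod 5 = 2 \<or> fps_nth F2 n = 0 \<and> fps_nth G2 n = 0"
    "n mod 5 = 3 \<or> fps_nth F3 n = 0 \<and> fps_nth G3 n = 0"
    "n mod 5 = 4 \<or> fps_nth F4 n = 0 \<and> fps_nth G4 n = 0" for n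
    using assms(1-10) unfolding supp5_def by blast+
  have "fps_nth F0 n = fps_nth G0 n \<and> fps_nth F1 n = fps_nth G1 n \<and> fps_nth F2 n = fps_nth G2 n \<and>
      fps_nth F3 n = fps_nth G3 n \<and> fps_nth F4 n = fps_nth G4 n" for n
    using e[of n] z[of n] by auto
  then show "F0 = G0" "F1 = G1" "F2 = G2" "F3 = G3" "F4 = G4"
    by (auto intro: fps_ext)
qed

section \<open>Theta series and their products\<close>

definition alt :: "int \<Rightarrow> int" where
  "alt j = (if even j then 1 else - 1)"

lemma alt_uminus: "alt (- j) = alt j"
  and alt_mult5: "alt (5 * j) = alt j"
  by (auto simp: alt_def)

text \<open>
  The exponent $(a+b)\,j(j-1)/2 + a j$, written with natural numbers only.
\<close>

definition theta_exp :: "nat \<Rightarrow> nat \<Rightarrow> int \<Rightarrow> nat" where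
  "theta_exp a b j = (if j \<ge> 0 then a * nat j + (a + b) * (nat j choose 2)
     else b * nat (- j) + (a + b) * (nat (- j) choose 2))"

lemma choose_2_int: "2 * int (n choose 2) = int n * (int n - 1)"
  by (induction n) (auto simp: Suc_choose_2 binomial_eq_0 algebra_simps)

lemma theta_exp_eq: "2 * int (theta_exp a b j) = int (a + b) * (j * (j - 1)) + 2 * int a * j"
proof (cases "j \<ge> 0")
  case True
  then obtain n where n: "j = int n" by (metis nonneg_int_cases)
  have "2 * int (theta_exp a b j) = 2 * int a * j + int (a + b) * (2 * int (n choose 2))"
    using n by (simp add: theta_exp_def algebra_simps)
  then show ?thesis unfolding choose_2_int using n by (simp add: algebra_simps)
next
  case False
  then obtain n where n: "j = - int n" "n > 0" by (metis neg_int_cases not_le)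
  have "2 * int (theta_exp a b j) = 2 * int b * int n + int (a + b) * (2 * int (n choose 2))"
    using n by (simp add: theta_exp_def algebra_simps)
  then show ?thesis unfolding choose_2_int using n by (simp add: algebra_simps)
qed

lemma theta_exp_ge:
  assumes "a + b > 0"
  shows "\<bar>j\<bar> \<le> int (theta_exp a b j) + 1"
proof -
  have "2 * int (n choose 2) \<ge> 2 * (int n - 1)" for n
  proof (cases "n \<le> 1")
    case True
    then show ?thesis unfolding choose_2_int by (cases n) auto
  next
    case False
    then have "2 * (int n - 1) \<le> int n * (int n - 1)" by (intro mult_right_mono) auto
    then show ?thesis unfolding choose_2_int .
  qed
  then have le: "2 * (int n - 1) \<le> 2 * int (n choose 2)" for n .
  have c: "int n \<le> int (n choose 2) + 1" for n
  proof -
    have "x \<le> y + 1" if "2 * (x - 1) \<le> 2 * y" for x y :: int using that by simp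
    from this[OF le] show ?thesis .
  qed
  have d: "int m \<le> int ((a + b) * m)" for m
    using assms by (cases "a + b") auto
  have combine: "J \<le> A + D + 1" if "J \<le> C + 1" "C \<le> D" "0 \<le> A" for J A C D :: int
    using that by simp
  show ?thesis
  proof (cases "j \<ge> 0")
    case True
    then have "int (theta_exp a b j) = int a * j + int ((a + b) * (nat j choose 2))"
      by (simp add: theta_exp_def)
    moreover have "j \<le> int a * j + int ((a + b) * (nat j choose 2)) + 1"
      by (rule combine[OF _ d]) (use c[of "nat j"] True in simp_all)
    ultimately show ?thesis using True by simp
  next
    case False
    then have "int (theta_exp a b j) = int b * (- j) + int ((a + b) * (nat (- j) choose 2))"
      by (simp add: theta_exp_def)
    moreover have "- j \<le> int b * (- j) + int ((a + b) * (nat (- j) choose 2)) + 1"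
      by (rule combine[OF _ d], use c[of "nat (- j)"] False in simp)
         (use False in \<open>intro mult_nonneg_nonneg; simp\<close>)
    ultimately show ?thesis using False by simp
  qed
qed

lemma triple_product_genfun:
  fixes \<sigma> :: int
  assumes "a + b > 0" "\<sigma> * \<sigma> = 1"
  shows "qinf (- (fps_const \<sigma> * fps_X ^ a)) (fps_X ^ (a + b)) *
      qinf (- (fps_const \<sigma> * fps_X ^ b)) (fps_X ^ (a + b)) * qinf (fps_X ^ (a + b)) (fps_X ^ (a + b)) =
    genfun UNIV (theta_exp a b) (\<lambda>j. \<sigma> ^ nat \<bar>j\<bar>)"
proof (rule fps_ext)
  fix k
  let ?x = "fps_const \<sigma> * fps_X ^ a" and ?y = "fps_const \<sigma> * fps_X ^ b" and ?q = "fps_X ^ (a + b)"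
  let ?L = "qinf (- ?x) ?q * qinf (- ?y) ?q * qinf ?q ?q"
  let ?J = "{- int (Suc k)..int (Suc k)}"
  have "?x * ?y = fps_const (\<sigma> * \<sigma>) * ?q"
    unfolding fps_const_mult [symmetric] power_add by (simp only: mult_ac)
  then have xy: "?x * ?y = ?q" using assms(2) by simp
  have tt: "theta_term ?x ?y ?q j = fps_const (\<sigma> ^ nat \<bar>j\<bar>) * fps_X ^ theta_exp a b j" for j
    by (simp add: theta_term_def theta_exp_def power_mult_distrib fps_const_power
        power_add power_mult mult.assoc)
  have "fps_X ^ Suc k dvd ?L - (\<Sum>j\<in>?J. theta_term ?x ?y ?q j)"
    using assms by (intro triple_product xy) simp
  then have "fps_nth ?L k = fps_nth (\<Sum>j\<in>?J. theta_term ?x ?y ?q j) k"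
    unfolding fps_X_power_dvd_iff by simp
  also have "\<dots> = (\<Sum>j\<in>?J. if theta_exp a b j = k then \<sigma> ^ nat \<bar>j\<bar> else 0)"
    by (auto simp: tt fps_sum_nth fps_X_power_nth intro!: sum.cong)
  also have "\<dots> = (\<Sum>j\<in>{j\<in>?J. theta_exp a b j = k}. \<sigma> ^ nat \<bar>j\<bar>)"
    by (rule sum.inter_filter [symmetric]) simp
  also have "{j\<in>?J. theta_exp a b j = k} = {j\<in>UNIV. theta_exp a b j = k}"
  proof -
    have "j \<in> ?J" if "theta_exp a b j = k" for j
      using theta_exp_ge[OF assms(1), of j] that by auto
    then show ?thesis by blast
  qed
  finally show "fps_nth ?L k = fps_nth (genfun UNIV (theta_exp a b) (\<lambda>j. \<sigma> ^ nat \<bar>j\<bar>)) k"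
    by (simp add: genfun_def)
qed

lemma finite_fibres_theta_exp:
  assumes "a + b > 0"
  shows "finite_fibres UNIV (theta_exp a b)"
  unfolding finite_fibres_def
proof
  fix k
  have "{j\<in>UNIV. theta_exp a b j = k} \<subseteq> {- int (Suc k)..int (Suc k)}"
    using theta_exp_ge[OF assms] by (auto simp: abs_le_iff) (smt (verit))+
  then show "finite {j\<in>UNIV. theta_exp a b j = k}" by (rule finite_subset) simp
qed

lemma alt_eq_power: "(- 1) ^ nat \<bar>j\<bar> = alt j"
  by (auto simp: alt_def uminus_power_if even_nat_iff)

definition pent :: "int \<Rightarrow> nat" where "pent = theta_exp 1 2"
definition square :: "int \<Rightarrow> nat" where "square = theta_exp 1 1"

text \<open>
  The pentagonal number series; it equals $(q;q)_\infty$ by \<open>euler_eq_qinf\<close>.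
\<close>

definition euler :: "int fps" where "euler = genfun UNIV pent alt"
text \<open>
  Gauss's series $\sum_n (-1)^n q^{n^2}$, often written $\varphi(-q)$.
\<close>

definition phi :: "int fps" where "phi = genfun UNIV square alt"

lemma pent_eq: "2 * int (pent j) = j * (3 * j - 1)"
  using theta_exp_eq[of 1 2 j] by (simp add: pent_def algebra_simps)

lemma square_eq: "int (square j) = j\<^sup>2"
  using theta_exp_eq[of 1 1 j] by (simp add: square_def algebra_simps power2_eq_square)

lemma finite_fibres_pent: "finite_fibres UNIV pent"
  and finite_fibres_square: "finite_fibres UNIV square"
  by (simp_all add: pent_def square_def finite_fibres_theta_exp)

lemma minus_const_minus_one_mult: "- (fps_const (- 1) * F) = (F :: int fps)"
  by (simp flip: fps_const_neg)

lemma euler_eq_qinf: "euler = qinf fps_X fps_X"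
proof -
  have 3: "1 + 2 = (3 :: nat)" by simp
  have "euler = qinf (fps_X ^ 1) (fps_X ^ 3) * qinf (fps_X ^ 2) (fps_X ^ 3) *
      qinf (fps_X ^ 3) (fps_X ^ 3)"
    using triple_product_genfun[of 1 2 "- 1", unfolded minus_const_minus_one_mult alt_eq_power 3]
    by (simp add: euler_def pent_def)
  moreover have e: "fps_X * fps_X ^ 2 = (fps_X ^ 3 :: int fps)" "fps_X * fps_X = (fps_X ^ 2 :: int fps)"
    by (simp_all add: power2_eq_square power3_eq_cube mult.assoc)
  ultimately show ?thesis
    using qinf_three[of fps_X fps_X, unfolded e] by simp
qed

lemma phi_eq_qinf: "phi = (qinf fps_X (fps_X ^ 2))\<^sup>2 * qinf (fps_X ^ 2) (fps_X ^ 2)"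
proof -
  have "phi = qinf (fps_X ^ 1) (fps_X ^ 2) * qinf (fps_X ^ 1) (fps_X ^ 2) *
      qinf (fps_X ^ 2) (fps_X ^ 2)"
    using triple_product_genfun[of 1 1 "- 1", unfolded minus_const_minus_one_mult alt_eq_power one_add_one]
    by (simp add: phi_def square_def)
  then show ?thesis by (simp add: power2_eq_square)
qed

lemma dil_qpoch: "m > 0 \<Longrightarrow> dil m (qpoch a q n) = qpoch (dil m a) (dil m q) n"
  by (induction n) (simp_all add: qpoch_Suc dil_mult dil_diff dil_power dil_one)

lemma dil_dvd: "m > 0 \<Longrightarrow> fps_X ^ n dvd F \<Longrightarrow> fps_X ^ n dvd dil m F"
  unfolding fps_X_power_dvd_iff
  by (auto simp: dil_nth) (metis div_le_dividend le_less_trans)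

lemma dil_qinf:
  assumes "m > 0" "fps_nth q 0 = 0"
  shows "dil m (qinf a q) = qinf (dil m a) (dil m q)"
proof (rule fps_eq_if_dvd_all)
  fix k
  have "fps_X ^ k dvd dil m (qinf a q - qpoch a q k)"
    using assms by (intro dil_dvd qinf_trunc)
  moreover have "fps_X ^ k dvd qinf (dil m a) (dil m q) - qpoch (dil m a) (dil m q) k"
    using assms by (intro qinf_trunc) (simp add: dil_nth)
  ultimately have "fps_X ^ k dvd dil m (qinf a q) - qpoch (dil m a) (dil m q) k -
      (qinf (dil m a) (dil m q) - qpoch (dil m a) (dil m q) k)"
    unfolding dil_diff dil_qpoch[OF assms(1)] by (rule dvd_diff)
  then show "fps_X ^ k dvd dil m (qinf a q) - qinf (dil m a) (dil m q)" by simp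
qed

text \<open>
  The only product identity that the dissections use.
\<close>

lemma phi_times_euler: "phi * dil 2 euler = euler ^ 2"
proof -
  have e: "euler = qinf fps_X (fps_X ^ 2) * qinf (fps_X ^ 2) (fps_X ^ 2)"
    using qinf_even_odd[of fps_X fps_X] by (simp add: euler_eq_qinf power2_eq_square)
  have d: "dil 2 euler = qinf (fps_X ^ 2) (fps_X ^ 2)"
    by (simp add: euler_eq_qinf dil_qinf dil_X)
  show ?thesis unfolding d phi_eq_qinf by (subst e) (simp add: power2_eq_square)
qed

section \<open>The 5-dissections of the theta series\<close>

definition cls :: "int \<Rightarrow> int set" where "cls r = {j. j mod 5 = r}"

lemma genfun_classes:
  assumes "finite_fibres UNIV e"
  shows "genfun UNIV e c = genfun (cls 0) e c + genfun (cls 1) e c + genfun (cls 2) e c +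
    genfun (cls 3) e c + genfun (cls 4) e c"
proof -
  have "genfun UNIV e c = (\<Sum>r\<in>{0,1,2,3,4}. genfun (cls r) e c)"
  proof (rule genfun_UNION[OF assms])
    have "j mod 5 \<in> {0,1,2,3,4}" for j :: int
    proof -
      have "0 \<le> j mod 5" "j mod 5 < 5" by simp_all
      then show ?thesis by auto
    qed
    then show "UNIV = (\<Union>r\<in>{0,1,2,3,4}. cls r)" by (auto simp: cls_def)
  qed (auto simp: cls_def)
  then show ?thesis by (simp add: add.assoc)
qed

lemma bij_cls: "bij_betw (\<lambda>i. 5 * i + r) UNIV (cls r)" if "0 \<le> r" "r < 5" for r :: int
proof (rule bij_betwI[where g = "\<lambda>j. j div 5"])
  show "(\<lambda>i. 5 * i + r) \<in> UNIV \<rightarrow> cls r" using that by (auto simp: cls_def)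
  show "5 * (j div 5) + r = j" if "j \<in> cls r" for j
    using that mult_div_mod_eq[of 5 j] by (auto simp: cls_def)
qed (use that in auto)

lemma bij_cls_uminus:
  assumes "0 < r" "r < 5"
  shows "bij_betw uminus (cls r) (cls (5 - r))"
  by (rule bij_betwI[where g = uminus])
     (use assms in \<open>auto simp: cls_def zmod_zminus1_eq_if\<close>)

text \<open>
  Half of the parts of \<open>phi\<close> with exponents congruent to 1 and to 4 modulo 5; the residues 1 and 4
  of the index give the first part, the residues 2 and 3 give the second one.
\<close>

definition phi1 :: "int fps" where "phi1 = genfun (cls 1) square alt"
definition phi4 :: "int fps" where "phi4 = genfun (cls 2) square alt"

lemma square_uminus: "square (- j) = square j"
  using square_eq[of j] square_eq[of "- j"] by simp

lemma square_mult5: "square (5 * j) = 25 * square j"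
  using square_eq[of j] square_eq[of "5 * j"] by (simp add: power_mult_distrib)

lemma square_mod5: "square j mod 5 = (nat (j mod 5))\<^sup>2 mod 5"
proof -
  have "int (square j mod 5) = (j mod 5)\<^sup>2 mod 5"
    by (simp add: square_eq of_nat_mod power_mod)
  also have "\<dots> = int ((nat (j mod 5))\<^sup>2 mod 5)"
    by (simp add: of_nat_mod)
  finally show ?thesis by (simp only: of_nat_eq_iff)
qed

lemma supp5_phi1: "supp5 1 phi1"
  unfolding phi1_def by (rule supp5_genfun) (auto simp: square_mod5 cls_def)

lemma supp5_phi4: "supp5 4 phi4"
  unfolding phi4_def by (rule supp5_genfun) (auto simp: square_mod5 cls_def)

lemma phi_cls0: "genfun (cls 0) square alt = dil 25 phi"
  by (subst genfun_reindex[OF bij_cls[of 0]])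
     (auto simp: phi_def dil_genfun square_mult5 alt_mult5)

lemma phi_cls3: "genfun (cls 3) square alt = phi4"
  using genfun_reindex[OF bij_cls_uminus[of 2], of square alt]
  by (simp add: phi4_def square_uminus alt_uminus)

lemma phi_cls4: "genfun (cls 4) square alt = phi1"
  using genfun_reindex[OF bij_cls_uminus[of 1], of square alt]
  by (simp add: phi1_def square_uminus alt_uminus)

lemma phi_dissection: "phi = dil 25 phi + 2 * phi1 + 2 * phi4"
proof -
  have "phi = dil 25 phi + phi1 + phi4 + phi4 + phi1"
    using genfun_classes[OF finite_fibres_square, of alt]
    unfolding phi_def[symmetric] phi_cls0 phi_cls3 phi_cls4 phi1_def[symmetric] phi4_def[symmetric] .
  also have "\<dots> = dil 25 phi + 2 * phi1 + 2 * phi4" by simp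
  finally show ?thesis .
qed

lemma finite_fibres_Times:
  assumes "finite_fibres I e" "finite_fibres J e'"
  shows "finite_fibres (I \<times> J) (\<lambda>(i, j). e i + e' j)"
  unfolding finite_fibres_def
proof
  fix k
  have "{p \<in> I \<times> J. (case p of (i, j) \<Rightarrow> e i + e' j) = k} \<subseteq>
      (\<Union>m\<le>k. {i\<in>I. e i = m}) \<times> (\<Union>m\<le>k. {j\<in>J. e' j = m})"
    by auto
  then show "finite {p \<in> I \<times> J. (case p of (i, j) \<Rightarrow> e i + e' j) = k}"
    by (rule finite_subset) (use assms in \<open>auto simp: finite_fibres_def\<close>)
qed

text \<open>
  The left-hand side runs over the lattice vectors $(m,n)$ with weight $5(m^2+n^2)$, and
  $5(m^2+n^2) = (2m+n)^2+(m-2n)^2$. The pairs $(2m+n, m-2n)$ are exactly the $(x,y)$ with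
  $x \equiv 2y$ modulo 5, and they keep their signs. Splitting by the class of $y$ gives one product
  of two multiples of 5 and four products of a class $\pm 1$ with a class $\pm 2$.
\<close>

lemma phi_squared: "(dil 5 phi)\<^sup>2 = (dil 25 phi)\<^sup>2 + 4 * phi1 * phi4"
proof -
  let ?e = "\<lambda>(i, j). square i + square j" and ?c = "\<lambda>(i, j). alt i * alt j"
  let ?C = "\<lambda>r. cls (2 * r mod 5) \<times> cls r"
  let ?L = "\<Union>r\<in>{0,1,2,3,4}. ?C r"
  have sub: "finite_fibres A square" for A
    by (rule finite_fibres_subset[OF finite_fibres_square]) simp
  have fin: "finite_fibres A ?e" for A
    by (rule finite_fibres_subset[OF finite_fibres_Times[OF finite_fibres_square finite_fibres_square]]) simp
  have L: "?L = {(x, y). 5 dvd x - 2 * y}"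
  proof -
    have iff: "(x, y) \<in> ?L \<longleftrightarrow> 5 dvd x - 2 * y" for x y
    proof -
      have "0 \<le> y mod 5" "y mod 5 < 5" by simp_all
      then have "y mod 5 \<in> {0,1,2,3,4}" by auto
      then have "(x, y) \<in> ?L \<longleftrightarrow> x mod 5 = 2 * (y mod 5) mod 5"
        unfolding cls_def by auto
      also have "2 * (y mod 5) mod 5 = (2 * y) mod 5" by (rule mod_mult_right_eq)
      finally show ?thesis by (simp only: mod_eq_dvd_iff)
    qed
    show ?thesis
    proof (rule set_eqI)
      fix p show "p \<in> ?L \<longleftrightarrow> p \<in> {(x, y). 5 dvd x - 2 * y}"
        using iff[of "fst p" "snd p"] by (simp only: prod.collapse mem_Collect_eq case_prod_unfold)
    qed
  qed
  have "dil 5 phi * dil 5 phi = dil 5 (genfun (UNIV \<times> UNIV) ?e ?c)"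
    by (simp add: phi_def dil_mult [symmetric] genfun_times finite_fibres_square)
  also have "\<dots> = genfun UNIV (\<lambda>p. 5 * ?e p) ?c"
    by (simp add: dil_genfun)
  also have "\<dots> = genfun ?L ?e ?c"
  proof -
    \<comment> \<open>$(n + m i)(1 - 2i) = (2m + n) + (m - 2n) i$, and $1 - 2i$ has norm 5.\<close>
    let ?h = "\<lambda>(m, n). (2 * m + n, m - 2 * n) :: int \<times> int"
    have "bij_betw ?h UNIV ?L"
      unfolding L
    proof (rule bij_betwI[where g = "\<lambda>(x, y). ((2 * x + y) div 5, (x - 2 * y) div 5)"])
      fix p :: "int \<times> int" assume "p \<in> {(x, y). 5 dvd x - 2 * y}"
      then obtain x y n where p: "p = (x, y)" "x - 2 * y = 5 * n" by (auto elim: dvdE)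
      then have x: "x = 2 * y + 5 * n" by simp
      have "2 * x + y = 5 * (2 * n + y)" unfolding x by simp
      then show "?h (case p of (x, y) \<Rightarrow> ((2 * x + y) div 5, (x - 2 * y) div 5)) = p"
        using p x by simp
    next
      fix p :: "int \<times> int"
      obtain m n where p: "p = (m, n)" by (cases p)
      have "2 * (2 * m + n) + (m - 2 * n) = 5 * m" "(2 * m + n) - 2 * (m - 2 * n) = 5 * n" by simp_all
      then show "(case ?h p of (x, y) \<Rightarrow> ((2 * x + y) div 5, (x - 2 * y) div 5)) = p"
        using p by simp
    next
      have "5 dvd (2 * m + n) - 2 * (m - 2 * n)" for m n :: int
      proof -
        have "(2 * m + n) - 2 * (m - 2 * n) = 5 * n" by simp
        then show ?thesis by simp
      qed
      then show "?h \<in> UNIV \<rightarrow> {(x, y). 5 dvd x - 2 * y}" by auto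
    qed auto
    then have "genfun ?L ?e ?c = genfun UNIV (\<lambda>p. ?e (?h p)) (\<lambda>p. ?c (?h p))"
      by (rule genfun_reindex)
    also have "\<dots> = genfun UNIV (\<lambda>p. 5 * ?e p) ?c"
    proof (rule genfun_cong)
      fix p :: "int \<times> int"
      obtain m n where p: "p = (m, n)" by (cases p)
      have "int (square (2 * m + n) + square (m - 2 * n)) = int (5 * (square m + square n))"
        by (simp add: square_eq power2_eq_square algebra_simps)
      then show "?e (?h p) = 5 * ?e p"
        using p by (simp only: of_nat_eq_iff split)
      show "?c (?h p) = ?c p" using p by (auto simp: alt_def)
    qed
    finally show ?thesis by simp
  qed
  also have "\<dots> = (\<Sum>r\<in>{0,1,2,3,4}. genfun (?C r) ?e ?c)"
  proof (rule genfun_UNION[OF fin])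
    show "?C r \<subseteq> ?L" if "r \<in> {0,1,2,3,4}" for r using that by (rule UN_upper)
    show "?C r \<inter> ?C s = {}" if "r \<noteq> s" for r s using that unfolding cls_def by blast
  qed simp_all
  also have "\<dots> = (\<Sum>r\<in>{0,1,2,3,4}. genfun (cls (2 * r mod 5)) square alt * genfun (cls r) square alt)"
    by (simp add: genfun_times sub)
  also have "\<dots> = (dil 25 phi)\<^sup>2 + 4 * phi1 * phi4"
    by (simp add: phi_cls0 phi_cls3 phi_cls4 phi1_def[symmetric] phi4_def[symmetric]
        power2_eq_square algebra_simps)
  finally show ?thesis by (simp add: power2_eq_square)
qed

text \<open>
  The parts of \<open>euler\<close> with exponents congruent to 0 and 2, the second one with the opposite
  sign. The remaining part, with exponents congruent to 1, is again an Euler product.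
\<close>

definition euler0 :: "int fps" where "euler0 = genfun (cls 0) pent alt + genfun (cls 2) pent alt"
definition euler2 :: "int fps" where "euler2 = - (genfun (cls 3) pent alt + genfun (cls 4) pent alt)"

lemma pent_mod5: "pent j mod 5 = nat (3 * (j mod 5) * (3 * (j mod 5) - 1) mod 5)"
proof -
  have six: "p mod 5 = (6 * p) mod 5" for p :: int
    using mod_mult_self4[of 5 p p] by simp
  have "int (pent j) mod 5 = (3 * j * (3 * j - 1)) mod 5"
  proof -
    have "6 * int (pent j) = 3 * (2 * int (pent j))" by simp
    also have "\<dots> = 3 * j * (3 * j - 1)" unfolding pent_eq by simp
    finally show ?thesis using six[of "int (pent j)"] by (simp only:)
  qed
  also have "\<dots> = 3 * (j mod 5) * (3 * (j mod 5) - 1) mod 5"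
    by (intro mod_mult_cong mod_diff_cong) (simp_all add: mod_mult_right_eq)
  finally have "int (pent j mod 5) = 3 * (j mod 5) * (3 * (j mod 5) - 1) mod 5"
    by (simp add: of_nat_mod)
  then show ?thesis by simp
qed

lemma supp5_euler0: "supp5 0 euler0"
  unfolding euler0_def by (intro supp5_add supp5_genfun) (auto simp: pent_mod5 cls_def)

lemma supp5_euler2: "supp5 2 euler2"
  unfolding euler2_def by (intro supp5_add supp5_genfun supp5_uminus) (auto simp: pent_mod5 cls_def)

lemma euler_cls1: "genfun (cls 1) pent alt = - (fps_X * dil 25 euler)"
proof -
  have "bij_betw (\<lambda>i. 5 * (- i) + 1) UNIV (cls 1)"
    using bij_betw_trans[OF bij_uminus bij_cls[of 1]] by (simp add: comp_def)
  then have "genfun (cls 1) pent alt = genfun UNIV (\<lambda>i. pent (5 * (- i) + 1)) (\<lambda>i. alt (5 * (- i) + 1))"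
    by (rule genfun_reindex)
  also have "\<dots> = genfun UNIV (\<lambda>i. 1 + 25 * pent i) (\<lambda>i. - alt i)"
  proof (rule genfun_cong)
    fix i
    have "2 * int (pent (5 * (- i) + 1)) = 2 * int (1 + 25 * pent i)"
      using pent_eq[of "5 * (- i) + 1"] pent_eq[of i] by (simp add: algebra_simps)
    then have "int (pent (5 * (- i) + 1)) = int (1 + 25 * pent i)"
      by (metis mult_cancel_left zero_neq_numeral)
    then show "pent (5 * (- i) + 1) = 1 + 25 * pent i" by (simp only: of_nat_eq_iff)
    show "alt (5 * (- i) + 1) = - alt i" by (auto simp: alt_def)
  qed
  also have "\<dots> = - (fps_X ^ 1 * dil 25 euler)"
    unfolding euler_def dil_genfun[of 25, simplified] X_power_genfun uminus_genfun ..
  finally show ?thesis by simp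
qed

lemma euler_dissection: "euler = euler0 - fps_X * dil 25 euler - euler2"
proof -
  have "euler = genfun (cls 0) pent alt + - (fps_X * dil 25 euler) + genfun (cls 2) pent alt +
      genfun (cls 3) pent alt + genfun (cls 4) pent alt"
    using genfun_classes[OF finite_fibres_pent, of alt]
    unfolding euler_def[symmetric] euler_cls1 .
  also have "\<dots> = euler0 - fps_X * dil 25 euler - euler2"
    by (simp add: euler0_def euler2_def)
  finally show ?thesis .
qed

section \<open>Algebraic relations between the dissected parts\<close>

text \<open>
  The assumptions are what a comparison of residues in \<open>phi_times_euler\<close> yields when
  $\varphi(q) = D + 2a + 2b$, $E(q^2) = s - K - z$ and $E(q) = r - J - w$ are the dissections, with $E$ the
  Euler product. Eliminating \<open>r\<close>, \<open>w\<close> and \<open>J\<close> leaves relations for combinations of \<open>s\<close> and \<open>z\<close>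
  that are, up to a factor \<open>D\<close>, polynomials in \<open>a * b\<close>, \<open>D\<close> and \<open>K\<close>; these are the combinations that
  survive the extraction of a residue class. The last relation concerns $\varphi$ alone.
\<close>

lemma theta_relations:
  fixes D a b s z K r w J :: "'a :: idom"
  assumes nz: "D \<noteq> 0" "K \<noteq> 0" "a \<noteq> 0" "b \<noteq> 0" "(2::'a) \<noteq> 0"
    and h0: "D * s - 2 * a * z = r\<^sup>2"
    and h1: "2 * a * s - 2 * b * K = - 2 * r * J"
    and h3: "- 2 * a * K - 2 * b * z = 2 * J * w"
    and h4: "2 * b * s - D * z = w\<^sup>2"
    and J: "J\<^sup>2 = D * K" and rw: "r * w = J\<^sup>2" and sz: "s * z = K\<^sup>2"
  shows "a\<^sup>2 * s - b\<^sup>2 * z = D\<^sup>2 * K"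
    and "D * (b * s\<^sup>2 + a * z\<^sup>2) = (D\<^sup>2 + 2 * a * b) * K\<^sup>2"
    and "D * (b ^ 3 * s - a ^ 3 * z) = a * b * K * (2 * a * b - D\<^sup>2)"
    and "a ^ 4 * s\<^sup>2 + b ^ 4 * z\<^sup>2 = (D ^ 4 + 2 * a\<^sup>2 * b\<^sup>2) * K\<^sup>2"
    and "D * (a ^ 5 + b ^ 5) = a * b * (D ^ 4 - a * b * D\<^sup>2 + 2 * a\<^sup>2 * b\<^sup>2)"
proof -
  have cancel: "x = y" if "c * x = c * y" "c \<noteq> 0" for c x y :: 'a
    using that by simp
  have h1': "b * K - a * s = r * J"
  proof -
    have "2 * (b * K - a * s) = 2 * (r * J)" using h1 by algebra
    then show ?thesis by (rule cancel) (use nz in simp)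
  qed
  have h3': "a * K + b * z = - (J * w)"
  proof -
    have "2 * (a * K + b * z) = 2 * (- (J * w))" using h3 by algebra
    then show ?thesis by (rule cancel) (use nz in simp)
  qed
  show R2: "a\<^sup>2 * s - b\<^sup>2 * z = D\<^sup>2 * K"
  proof -
    have "(b * K - a * s) * (a * K + b * z) = - ((r * w) * J\<^sup>2)"
      unfolding h1' h3' by (simp add: power2_eq_square)
    also have "\<dots> = - (D\<^sup>2 * K\<^sup>2)" unfolding rw J by (simp add: power2_eq_square)
    finally have "K * (a\<^sup>2 * s - b\<^sup>2 * z) = K * (D\<^sup>2 * K)" using sz by algebra
    then show ?thesis by (rule cancel) (use nz in simp)
  qed
  have Ra: "b\<^sup>2 * K = a * b * s - a * D * z"
  proof -
    have "(b * K - a * s)\<^sup>2 = J\<^sup>2 * r\<^sup>2" unfolding h1' by (simp add: power_mult_distrib)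
    also have "\<dots> = D * K * (D * s - 2 * a * z)" unfolding J h0 ..
    finally have "(2 * K) * (b\<^sup>2 * K) = (2 * K) * (a * b * s - a * D * z)" using R2 sz by algebra
    then show ?thesis by (rule cancel) (use nz in simp)
  qed
  have Rb: "a\<^sup>2 * K = b * D * s - a * b * z"
  proof -
    have "(a * K + b * z)\<^sup>2 = J\<^sup>2 * w\<^sup>2" unfolding h3' by (simp add: power_mult_distrib)
    also have "\<dots> = D * K * (2 * b * s - D * z)" unfolding J h4 ..
    finally have "(2 * K) * (a\<^sup>2 * K) = (2 * K) * (b * D * s - a * b * z)" using R2 sz by algebra
    then show ?thesis by (rule cancel) (use nz in simp)
  qed
  show R3: "D * (b * s\<^sup>2 + a * z\<^sup>2) = (D\<^sup>2 + 2 * a * b) * K\<^sup>2"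
  proof -
    have "(b\<^sup>2 * K) * (a\<^sup>2 * K) = (a * b) * ((b * s - D * z) * (D * s - a * z))"
      unfolding Ra Rb by algebra
    then have "(a * b) * (a * b * K\<^sup>2) = (a * b) * ((b * s - D * z) * (D * s - a * z))"
      by algebra
    then have "a * b * K\<^sup>2 = (b * s - D * z) * (D * s - a * z)"
      by (rule cancel) (use nz in simp)
    then show ?thesis using sz by algebra
  qed
  show "D * (b ^ 3 * s - a ^ 3 * z) = a * b * K * (2 * a * b - D\<^sup>2)"
  proof -
    have "K * (b ^ 3 * s - a ^ 3 * z) = b * s * (b\<^sup>2 * K) - a * z * (a\<^sup>2 * K)"
      by (simp add: algebra_simps power2_eq_square power3_eq_cube)
    also have "\<dots> = a * b * (b * s\<^sup>2 + a * z\<^sup>2) - 2 * a * b * D * K\<^sup>2"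
      unfolding Ra Rb using sz by algebra
    finally have "K * (D * (b ^ 3 * s - a ^ 3 * z)) = K * (a * b * K * (2 * a * b - D\<^sup>2))"
      using R3 by algebra
    then show ?thesis by (rule cancel) (use nz in simp)
  qed
  show "a ^ 4 * s\<^sup>2 + b ^ 4 * z\<^sup>2 = (D ^ 4 + 2 * a\<^sup>2 * b\<^sup>2) * K\<^sup>2"
    using R2 sz by algebra
  show "D * (a ^ 5 + b ^ 5) = a * b * (D ^ 4 - a * b * D\<^sup>2 + 2 * a\<^sup>2 * b\<^sup>2)"
  proof -
    have "K\<^sup>2 * (a ^ 5 + b ^ 5) = a * (a\<^sup>2 * K)\<^sup>2 + b * (b\<^sup>2 * K)\<^sup>2"
      by algebra
    also have "\<dots> = a * b * ((D\<^sup>2 + a * b) * (b * s\<^sup>2 + a * z\<^sup>2) - 4 * a * b * D * K\<^sup>2)"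
      unfolding Ra Rb using sz by algebra
    finally have "K\<^sup>2 * (D * (a ^ 5 + b ^ 5)) =
        K\<^sup>2 * (a * b * (D ^ 4 - a * b * D\<^sup>2 + 2 * a\<^sup>2 * b\<^sup>2))"
      using R3 by algebra
    then show ?thesis by (rule cancel) (use nz in simp)
  qed
qed

definition parts ::
    "int fps \<Rightarrow> int fps \<Rightarrow> int fps \<Rightarrow> int fps \<Rightarrow> int fps \<Rightarrow> int fps \<Rightarrow> bool" where
  "parts F f0 f1 f2 f3 f4 \<longleftrightarrow> F = f0 + f1 + f2 + f3 + f4 \<and>
    supp5 0 f0 \<and> supp5 1 f1 \<and> supp5 2 f2 \<and> supp5 3 f3 \<and> supp5 4 f4"

lemma parts_mult:
  assumes "parts F f0 f1 f2 f3 f4" "parts G g0 g1 g2 g3 g4"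
  shows "parts (F * G)
    (f0 * g0 + f1 * g4 + f2 * g3 + f3 * g2 + f4 * g1)
    (f0 * g1 + f1 * g0 + f2 * g4 + f3 * g3 + f4 * g2)
    (f0 * g2 + f1 * g1 + f2 * g0 + f3 * g4 + f4 * g3)
    (f0 * g3 + f1 * g2 + f2 * g1 + f3 * g0 + f4 * g4)
    (f0 * g4 + f1 * g3 + f2 * g2 + f3 * g1 + f4 * g0)"
proof -
  have s: "supp5 0 f0" "supp5 1 f1" "supp5 2 f2" "supp5 3 f3" "supp5 4 f4"
    "supp5 0 g0" "supp5 1 g1" "supp5 2 g2" "supp5 3 g3" "supp5 4 g4"
    and F: "F = f0 + f1 + f2 + f3 + f4" and G: "G = g0 + g1 + g2 + g3 + g4"
    using assms by (auto simp: parts_def)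
  show ?thesis
    unfolding parts_def F G
    by (intro conjI supp5_add; (rule supp5_mult, (rule s)+, simp)?)
       (simp add: algebra_simps)
qed

lemma parts_unique:
  assumes "parts F f0 f1 f2 f3 f4" "parts F g0 g1 g2 g3 g4"
  shows "f0 = g0" "f1 = g1" "f2 = g2" "f3 = g3" "f4 = g4"
proof -
  have eq: "f0 + f1 + f2 + f3 + f4 = g0 + g1 + g2 + g3 + g4"
    and s: "supp5 0 f0" "supp5 1 f1" "supp5 2 f2" "supp5 3 f3" "supp5 4 f4"
      "supp5 0 g0" "supp5 1 g1" "supp5 2 g2" "supp5 3 g3" "supp5 4 g4"
    using assms by (simp_all add: parts_def)
  from supp5_unique[OF s eq] show "f0 = g0" "f1 = g1" "f2 = g2" "f3 = g3" "f4 = g4" by auto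
qed

lemma parts_phi: "parts phi (dil 25 phi) (2 * phi1) 0 0 (2 * phi4)"
proof -
  have "phi = dil 25 phi + 2 * phi1 + 0 + 0 + 2 * phi4"
    using phi_dissection by (simp only: add_0_right)
  moreover have "supp5 0 (dil 25 phi)" by (rule supp5_dil5) simp_all
  ultimately show ?thesis
    unfolding parts_def by (intro conjI supp5_numeral_mult supp5_phi1 supp5_phi4 supp5_0)
qed

lemma parts_euler: "parts euler euler0 (- (fps_X * dil 25 euler)) (- euler2) 0 0"
proof -
  have "euler = euler0 + - (fps_X * dil 25 euler) + - euler2 + 0 + 0"
    using euler_dissection by (simp only: diff_conv_add_uminus add_0_right)
  moreover have "supp5 1 (fps_X * dil 25 euler)"
    using supp5_X_power[of 1] by (intro supp5_mult[of 1 _ 0] supp5_dil5) simp_all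
  ultimately show ?thesis
    unfolding parts_def
    by (intro conjI supp5_uminus supp5_euler0 supp5_euler2 supp5_0)
qed

lemma parts_euler_dil2:
  "parts (dil 2 euler) (dil 2 euler0) 0 (- (fps_X\<^sup>2 * dil 50 euler)) 0 (- dil 2 euler2)"
proof -
  have "dil 2 euler = dil 2 euler0 - fps_X\<^sup>2 * dil 50 euler - dil 2 euler2"
    by (subst euler_dissection) (simp add: dil_diff dil_mult dil_X dil_dil)
  then have "dil 2 euler =
      dil 2 euler0 + 0 + - (fps_X\<^sup>2 * dil 50 euler) + 0 + - dil 2 euler2"
    by simp
  moreover have "supp5 2 (fps_X\<^sup>2 * dil 50 euler)"
    using supp5_X_power[of 2] by (intro supp5_mult[of 2 _ 0] supp5_dil5) simp_all
  moreover have "supp5 0 (dil 2 euler0)" "supp5 4 (dil 2 euler2)"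
    by (rule supp5_dil[OF supp5_euler0] supp5_dil[OF supp5_euler2]; simp)+
  ultimately show ?thesis
    unfolding parts_def by (intro conjI supp5_uminus supp5_0)
qed

text \<open>
  The digit is the residue modulo 5 of the exponents: \<open>phi0\<close> belongs to \<open>phi\<close>, \<open>euler1\<close> to \<open>euler\<close>, and
  \<open>E0\<close>, \<open>E2\<close>, \<open>E4\<close> to the Euler product in $q^2$, which is \<open>E0 - E2 - E4\<close>.
\<close>

abbreviation (input) "phi0 \<equiv> dil 25 phi"
abbreviation (input) "E2 \<equiv> fps_X\<^sup>2 * dil 50 euler"
abbreviation (input) "E0 \<equiv> dil 2 euler0"
abbreviation (input) "E4 \<equiv> dil 2 euler2"
abbreviation (input) "euler1 \<equiv> fps_X * dil 25 euler"

lemma phi_nth_0: "fps_nth phi 0 = 1"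
  by (simp add: phi_eq_qinf qinf_nth_0 power2_eq_square)

lemma euler_nth_0: "fps_nth euler 0 = 1"
  by (simp add: euler_eq_qinf qinf_nth_0)

lemma dil_nth_0: "m > 0 \<Longrightarrow> fps_nth (dil m F) 0 = fps_nth F 0"
  by (simp add: dil_nth)

lemma nonzero_if_nth_nonzero: "fps_nth F n \<noteq> 0 \<Longrightarrow> F \<noteq> 0"
  by auto

lemma phi1_nonzero: "phi1 \<noteq> 0"
proof -
  have "{j \<in> cls 1. square j = 1} = {1}"
  proof -
    have "j = 1" if "j mod 5 = 1" "square j = 1" for j
    proof -
      have "j\<^sup>2 = 1" using square_eq[of j] that by simp
      then show ?thesis using that by (auto simp: power2_eq_1_iff)
    qed
    moreover have "square 1 = 1" using square_eq[of 1] by simp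
    ultimately show ?thesis by (auto simp: cls_def)
  qed
  then have "fps_nth phi1 1 = alt 1" by (simp add: phi1_def genfun_def)
  then show ?thesis by (auto simp: alt_def)
qed

lemma phi4_nonzero: "phi4 \<noteq> 0"
proof -
  have "{j \<in> cls 2. square j = 4} = {2}"
  proof -
    have "j = 2" if "j mod 5 = 2" "square j = 4" for j
    proof -
      have "j\<^sup>2 = 2\<^sup>2" using square_eq[of j] that by simp
      then show ?thesis using that unfolding power2_eq_iff by auto
    qed
    moreover have "square 2 = 4" using square_eq[of 2] by simp
    ultimately show ?thesis by (auto simp: cls_def)
  qed
  then have "fps_nth phi4 4 = alt 2" by (simp add: phi4_def genfun_def)
  then show ?thesis by (auto simp: alt_def)
qed

text \<open>
  The five residues of \<open>phi_times_euler\<close>, from 0 to 4.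
\<close>

lemma parts_phi_times_euler:
  "phi0 * E0 - 2 * phi1 * E4 = euler0\<^sup>2"
  "2 * phi1 * E0 - 2 * phi4 * E2 = - 2 * euler0 * euler1"
  "- (phi0 * E2) = euler1\<^sup>2 - 2 * euler0 * euler2"
  "- 2 * phi1 * E2 - 2 * phi4 * E4 = 2 * euler1 * euler2"
  "2 * phi4 * E0 - phi0 * E4 = euler2\<^sup>2"
proof -
  have e: "phi * dil 2 euler = euler * euler"
    using phi_times_euler by (simp add: power2_eq_square)
  note U = parts_unique[OF parts_mult[OF parts_phi parts_euler_dil2]
      parts_mult[OF parts_euler parts_euler, folded e]]
  show "phi0 * E0 - 2 * phi1 * E4 = euler0\<^sup>2" using U(1) by (simp add: algebra_simps power2_eq_square)
  show "2 * phi1 * E0 - 2 * phi4 * E2 = - 2 * euler0 * euler1" using U(2) by (simp add: algebra_simps)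
  show "- (phi0 * E2) = euler1\<^sup>2 - 2 * euler0 * euler2" using U(3) by (simp add: algebra_simps power2_eq_square)
  show "- 2 * phi1 * E2 - 2 * phi4 * E4 = 2 * euler1 * euler2" using U(4) by algebra
  show "2 * phi4 * E0 - phi0 * E4 = euler2\<^sup>2" using U(5) by (simp add: algebra_simps power2_eq_square)
qed

lemma euler1_squared: "euler1\<^sup>2 = phi0 * E2"
proof -
  have "dil 25 phi * dil 50 euler = dil 25 (phi * dil 2 euler)"
    by (simp add: dil_mult dil_dil)
  also have "\<dots> = (dil 25 euler)\<^sup>2" unfolding phi_times_euler by (simp add: dil_power)
  finally show ?thesis by (simp add: power_mult_distrib mult_ac)
qed

text \<open>
  Ramanujan's observation that the two outer parts of the Euler product are reciprocal up to
  normalisation. Here it is the residue 2 of \<open>phi_times_euler\<close>, combined with the same identity in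
  $q^{25}$, which says that \<open>phi0 * E2\<close> is the square of the middle part.
\<close>

lemma euler0_times_euler2: "euler0 * euler2 = euler1\<^sup>2"
proof -
  have "2 * (euler0 * euler2) = 2 * euler1\<^sup>2"
    using parts_phi_times_euler(3) euler1_squared by algebra
  then show ?thesis by (metis mult_left_cancel zero_neq_numeral)
qed

lemma E0_times_E4: "E0 * E4 = E2\<^sup>2"
proof -
  have "E0 * E4 = dil 2 (euler0 * euler2)" by (simp add: dil_mult)
  also have "\<dots> = E2\<^sup>2"
    unfolding euler0_times_euler2 by (simp add: dil_mult dil_power dil_X dil_dil)
  finally show ?thesis .
qed

lemma phi0_nonzero: "phi0 \<noteq> 0"
  by (rule nonzero_if_nth_nonzero[of _ 0]) (simp add: dil_nth_0 phi_nth_0)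

lemma E2_nonzero: "E2 \<noteq> 0"
proof -
  have "dil 50 euler \<noteq> 0" by (rule nonzero_if_nth_nonzero[of _ 0]) (simp add: dil_nth_0 euler_nth_0)
  then show ?thesis by simp
qed

lemmas parts_relations = theta_relations[OF phi0_nonzero E2_nonzero phi1_nonzero phi4_nonzero _
   parts_phi_times_euler(1,2,4,5) euler1_squared euler0_times_euler2 E0_times_E4, simplified]

section \<open>Extracting a residue class modulo 5\<close>

definition sec :: "nat \<Rightarrow> int fps \<Rightarrow> int fps" where
  "sec r F = Abs_fps (\<lambda>n. fps_nth F (5 * n + r))"

lemma sec_nth: "fps_nth (sec r F) n = fps_nth F (5 * n + r)"
  by (simp add: sec_def)

lemma sec_add: "sec r (F + G) = sec r F + sec r G"
  by (rule fps_ext) (simp add: sec_nth)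

lemma sec_diff: "sec r (F - G) = sec r F - sec r G"
  by (rule fps_ext) (simp add: sec_nth)

lemma sec_numeral_mult: "sec r (numeral k * F) = numeral k * sec r F"
  by (rule fps_ext) (simp add: sec_nth numeral_fps_const)

lemma sec_supp5_0: "supp5 s F \<Longrightarrow> r < 5 \<Longrightarrow> r \<noteq> s \<Longrightarrow> sec r F = 0"
  by (rule fps_ext) (auto simp: sec_nth supp5_def)

lemma sec_parts:
  assumes "parts F f0 f1 f2 f3 f4"
  shows "sec 0 F = sec 0 f0" "sec 4 F = sec 4 f4"
  using assms by (auto simp: parts_def sec_add sec_supp5_0)

text \<open>
  Extraction is linear over the series in $q^5$.
\<close>

lemma sec_dil_mult:
  assumes "r < 5"
  shows "sec r (dil 5 G * F) = G * sec r F"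
proof (rule fps_ext)
  fix n
  have "fps_nth (sec r (dil 5 G * F)) n =
      (\<Sum>i\<in>{0..5 * n + r}. fps_nth (dil 5 G) i * fps_nth F (5 * n + r - i))"
    by (simp add: sec_nth fps_mult_nth)
  also have "\<dots> = (\<Sum>i\<in>(\<lambda>j. 5 * j) ` {0..n}. fps_nth (dil 5 G) i * fps_nth F (5 * n + r - i))"
  proof (rule sum.mono_neutral_right)
    show "\<forall>i\<in>{0..5 * n + r} - (\<lambda>j. 5 * j) ` {0..n}. fps_nth (dil 5 G) i * fps_nth F (5 * n + r - i) = 0"
    proof
      fix i assume i: "i \<in> {0..5 * n + r} - (\<lambda>j. 5 * j) ` {0..n}"
      have "\<not> 5 dvd i"
      proof
        assume "5 dvd i"
        then obtain j where "i = 5 * j" by (elim dvdE)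
        with i assms show False by auto
      qed
      then show "fps_nth (dil 5 G) i * fps_nth F (5 * n + r - i) = 0" by (simp add: dil_nth)
    qed
  qed auto
  also have "\<dots> = (\<Sum>j\<in>{0..n}. fps_nth (dil 5 G) (5 * j) * fps_nth F (5 * n + r - 5 * j))"
    by (subst sum.reindex) (auto simp: inj_on_def)
  also have "\<dots> = fps_nth (G * sec r F) n"
    unfolding fps_mult_nth
  proof (rule sum.cong)
    fix j assume "j \<in> {0..n}"
    then have "5 * n + r - 5 * j = 5 * (n - j) + r" by simp
    then show "fps_nth (dil 5 G) (5 * j) * fps_nth F (5 * n + r - 5 * j) =
        fps_nth G j * fps_nth (sec r F) (n - j)"
      by (simp add: dil_nth sec_nth)
  qed simp
  finally show "fps_nth (sec r (dil 5 G * F)) n = fps_nth (G * sec r F) n" .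
qed

lemma sec_dil:
  "sec 0 (dil 5 G) = G"
  by (rule fps_ext) (simp add: sec_nth dil_nth)

lemma sec_X4_dil: "sec 4 (fps_X ^ 4 * dil 5 G) = G"
  by (rule fps_ext) (simp add: sec_nth dil_nth fps_X_power_mult_nth)

definition eulersq :: "int fps" where "eulersq = (dil 2 euler)\<^sup>2"
abbreviation "phi5 \<equiv> dil 5 phi"
abbreviation "eulersq5 \<equiv> dil 5 eulersq"

lemma E2_squared: "E2\<^sup>2 = fps_X ^ 4 * dil 5 eulersq5"
  by (simp add: eulersq_def dil_power dil_dil power_mult_distrib)

lemma phi0_eq: "phi0 = dil 5 phi5"
  by (simp add: dil_dil)

text \<open>
  With \<open>a\<close>, \<open>b\<close> the halves of the two outer parts of \<open>phi\<close>, both \<open>a * b\<close> and \<open>a ^ 5 + b ^ 5\<close> are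
  rational in $\varphi(q^5)$ and $\varphi(q^{25})$, so \<open>phi\<close> is a root of a quintic over the series in $q^5$,
  the analogue of the degree 5 modular equation. All coefficients except the first and the last
  are divisible by 5, and that is the source of the congruences.
\<close>

lemma phi_quintic:
  "phi0 * phi ^ 5 - 5 * phi0\<^sup>2 * phi ^ 4 + (15 * phi0 ^ 3 - 5 * phi0 * phi5\<^sup>2) * phi ^ 3
   - (25 * phi0 ^ 4 - 15 * phi0\<^sup>2 * phi5\<^sup>2) * phi\<^sup>2
   + (25 * phi0 ^ 5 - 25 * phi0 ^ 3 * phi5\<^sup>2 + 5 * phi0 * phi5 ^ 4) * phi = phi5 ^ 6"
proof -
  have gen: "D * f ^ 5 - 5 * D\<^sup>2 * f ^ 4 + (15 * D ^ 3 - 5 * D * P\<^sup>2) * f ^ 3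
     - (25 * D ^ 4 - 15 * D\<^sup>2 * P\<^sup>2) * f\<^sup>2 + (25 * D ^ 5 - 25 * D ^ 3 * P\<^sup>2 + 5 * D * P ^ 4) * f
     = P ^ 6"
    if f: "f = D + 2 * a + 2 * b" and P: "P\<^sup>2 = D\<^sup>2 + 4 * a * b"
      and R: "D * (a ^ 5 + b ^ 5) = a * b * (D ^ 4 - a * b * D\<^sup>2 + 2 * a\<^sup>2 * b\<^sup>2)"
    for D f P a b :: "int fps"
    using f P R by algebra
  show ?thesis by (rule gen[OF phi_dissection phi_squared parts_relations(5)])
qed

lemma parts_cong:
  assumes "parts F f0 f1 f2 f3 f4" "f0 = g0" "f1 = g1" "f2 = g2" "f3 = g3" "f4 = g4"
  shows "parts F g0 g1 g2 g3 g4"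
  using assms by simp

lemma parts_phi_2:
  "parts (phi\<^sup>2) (phi0\<^sup>2 + 8 * (phi1 * phi4)) (4 * (phi0 * phi1)) (4 * phi1\<^sup>2)
    (4 * phi4\<^sup>2) (4 * (phi0 * phi4))"
  unfolding power2_eq_square[of phi]
  by (rule parts_cong[OF parts_mult[OF parts_phi parts_phi]]; algebra)

lemma parts_phi_3:
  "parts (phi ^ 3) (phi0 ^ 3 + 24 * (phi0 * (phi1 * phi4)))
    (6 * (phi0\<^sup>2 * phi1) + 24 * (phi1\<^sup>2 * phi4))
    (12 * (phi0 * phi1\<^sup>2) + 8 * phi4 ^ 3)
    (12 * (phi0 * phi4\<^sup>2) + 8 * phi1 ^ 3)
    (6 * (phi0\<^sup>2 * phi4) + 24 * (phi1 * phi4\<^sup>2))"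
proof -
  have e: "phi ^ 3 = phi\<^sup>2 * phi" by (simp add: power2_eq_square power3_eq_cube)
  show ?thesis unfolding e
    by (rule parts_cong[OF parts_mult[OF parts_phi_2 parts_phi]]; algebra)
qed

lemma parts_phi_4:
  "parts (phi ^ 4) (phi0 ^ 4 + 48 * (phi0\<^sup>2 * (phi1 * phi4)) + 96 * (phi1 * phi4)\<^sup>2)
    (8 * (phi0 ^ 3 * phi1) + 96 * (phi0 * phi1\<^sup>2 * phi4) + 16 * phi4 ^ 4)
    (24 * (phi0\<^sup>2 * phi1\<^sup>2) + 32 * (phi0 * phi4 ^ 3) + 64 * (phi1 ^ 3 * phi4))
    (24 * (phi0\<^sup>2 * phi4\<^sup>2) + 32 * (phi0 * phi1 ^ 3) + 64 * (phi1 * phi4 ^ 3))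
    (8 * (phi0 ^ 3 * phi4) + 96 * (phi0 * phi1 * phi4\<^sup>2) + 16 * phi1 ^ 4)"
proof -
  have e: "phi ^ 4 = phi\<^sup>2 * phi\<^sup>2" by simp
  show ?thesis unfolding e
    by (rule parts_cong[OF parts_mult[OF parts_phi_2 parts_phi_2]]; algebra)
qed

lemma parts_eulersq:
  "parts eulersq (E0\<^sup>2) (2 * E2 * E4) (- 2 * E2 * E0) (E4\<^sup>2) (- E2\<^sup>2)"
  unfolding eulersq_def power2_eq_square[of "dil 2 euler"]
  by (rule parts_cong[OF parts_mult[OF parts_euler_dil2 parts_euler_dil2]])
     (use E0_times_E4 in algebra)+

text \<open>
  In the residue 0 part of these powers of \<open>phi\<close> the outer parts occur only through their product.
\<close>

lemma sec0_phi_powers: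
  "sec 0 1 = 1" "sec 0 phi = phi5" "sec 0 (phi\<^sup>2) = 2 * phi\<^sup>2 - phi5\<^sup>2"
  "sec 0 (phi ^ 3) = 6 * (phi5 * phi\<^sup>2) - 5 * phi5 ^ 3"
  "sec 0 (phi ^ 4) = 6 * phi ^ 4 - 5 * phi5 ^ 4"
proof -
  show "sec 0 1 = 1" using sec_dil[of 1] by (simp add: dil_one)
  show "sec 0 phi = phi5" unfolding sec_parts(1)[OF parts_phi] phi0_eq by (rule sec_dil)
  have "phi0\<^sup>2 + 8 * (phi1 * phi4) = 2 * phi5\<^sup>2 - phi0\<^sup>2" using phi_squared by algebra
  also have "\<dots> = dil 5 (2 * phi\<^sup>2 - phi5\<^sup>2)"
    by (simp add: dil_diff dil_mult dil_power dil_numeral phi0_eq)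
  finally show "sec 0 (phi\<^sup>2) = 2 * phi\<^sup>2 - phi5\<^sup>2"
    unfolding sec_parts(1)[OF parts_phi_2] by (simp only: sec_dil)
  have "phi0 ^ 3 + 24 * (phi0 * (phi1 * phi4)) = 6 * (phi0 * phi5\<^sup>2) - 5 * phi0 ^ 3"
    using phi_squared by algebra
  also have "\<dots> = dil 5 (6 * (phi5 * phi\<^sup>2) - 5 * phi5 ^ 3)"
    by (simp add: dil_diff dil_mult dil_power dil_numeral phi0_eq)
  finally show "sec 0 (phi ^ 3) = 6 * (phi5 * phi\<^sup>2) - 5 * phi5 ^ 3"
    unfolding sec_parts(1)[OF parts_phi_3] by (simp only: sec_dil)
  have "phi0 ^ 4 + 48 * (phi0\<^sup>2 * (phi1 * phi4)) + 96 * (phi1 * phi4)\<^sup>2 = 6 * phi5 ^ 4 - 5 * phi0 ^ 4"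
    using phi_squared by algebra
  also have "\<dots> = dil 5 (6 * phi ^ 4 - 5 * phi5 ^ 4)"
    by (simp add: dil_diff dil_mult dil_power dil_numeral phi0_eq)
  finally show "sec 0 (phi ^ 4) = 6 * phi ^ 4 - 5 * phi5 ^ 4"
    unfolding sec_parts(1)[OF parts_phi_4] by (simp only: sec_dil)
qed

text \<open>
  The residue 4 parts below are multiples of \<open>E2\<^sup>2\<close> up to the denominator \<open>phi0\<close>, and \<open>E2\<^sup>2\<close> is
  $q^4$ times a series in $q^5$.
\<close>

lemma sec4_from_E2_squared:
  assumes "phi0 * G = E2\<^sup>2 * dil 5 H"
  shows "phi5 * sec 4 G = eulersq5 * H"
proof -
  have "phi5 * sec 4 G = sec 4 (phi0 * G)"
    unfolding phi0_eq by (simp add: sec_dil_mult)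
  also have "phi0 * G = fps_X ^ 4 * dil 5 (eulersq5 * H)"
    unfolding assms E2_squared by (simp add: dil_mult)
  finally show ?thesis unfolding sec_X4_dil .
qed

text \<open>
  Five consecutive values, enough to start the recurrence.
\<close>

lemma sec4_eulersq_phi_powers:
  "sec 4 eulersq = - eulersq5"
  "phi5 * sec 4 (eulersq * phi) = eulersq5 * phi\<^sup>2"
  "sec 4 (eulersq * phi\<^sup>2) = - 5 * eulersq5 * phi5\<^sup>2"
  "phi5 * sec 4 (eulersq * phi ^ 3) = eulersq5 * (phi ^ 4 + 5 * (phi\<^sup>2 * phi5\<^sup>2) - 25 * phi5 ^ 4)"
  "sec 4 (eulersq * phi ^ 4) = - 25 * eulersq5 * phi5 ^ 4"
proof -
  note R = parts_relations(1-4)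
  have cancel: "F = G" if "phi5 * F = phi5 * G" for F G
    using that nonzero_if_nth_nonzero[of phi5 0] by (simp add: dil_nth_0 phi_nth_0)
  have 0: "phi0 * - E2\<^sup>2 = E2\<^sup>2 * dil 5 (- phi5)"
    by (simp add: dil_uminus phi0_eq)
  have "phi5 * sec 4 eulersq = eulersq5 * - phi5"
    unfolding sec_parts(2)[OF parts_eulersq] by (rule sec4_from_E2_squared[OF 0])
  then have "phi5 * sec 4 eulersq = phi5 * (- eulersq5)" by algebra
  then show "sec 4 eulersq = - eulersq5" by (rule cancel)
  note P1 = sec_parts(2)[OF parts_mult[OF parts_eulersq parts_phi]]
  show "phi5 * sec 4 (eulersq * phi) = eulersq5 * phi\<^sup>2"
    unfolding P1
    by (rule sec4_from_E2_squared, simp only: dil_power zero_less_numeral) (use R phi_squared in algebra)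
  note P2 = sec_parts(2)[OF parts_mult[OF parts_eulersq parts_phi_2]]
  have "phi5 * sec 4 (eulersq * phi\<^sup>2) = eulersq5 * (- 5 * phi5 ^ 3)"
    unfolding P2
    by (rule sec4_from_E2_squared, simp only: dil_power dil_mult dil_uminus dil_numeral zero_less_numeral phi0_eq[symmetric])
       (use R phi_squared in algebra)
  then have "phi5 * sec 4 (eulersq * phi\<^sup>2) = phi5 * (- 5 * eulersq5 * phi5\<^sup>2)" by algebra
  then show "sec 4 (eulersq * phi\<^sup>2) = - 5 * eulersq5 * phi5\<^sup>2" by (rule cancel)
  note P3 = sec_parts(2)[OF parts_mult[OF parts_eulersq parts_phi_3]]
  show "phi5 * sec 4 (eulersq * phi ^ 3) = eulersq5 * (phi ^ 4 + 5 * (phi\<^sup>2 * phi5\<^sup>2) - 25 * phi5 ^ 4)"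
    unfolding P3
    by (rule sec4_from_E2_squared, simp only: dil_power dil_mult dil_add dil_diff dil_numeral zero_less_numeral phi0_eq[symmetric])
       (use R phi_squared in algebra)
  note P4 = sec_parts(2)[OF parts_mult[OF parts_eulersq parts_phi_4]]
  have "phi5 * sec 4 (eulersq * phi ^ 4) = eulersq5 * (- 25 * phi5 ^ 5)"
    unfolding P4
    by (rule sec4_from_E2_squared, simp only: dil_power dil_mult dil_uminus dil_numeral zero_less_numeral phi0_eq[symmetric])
       (use R phi_squared in algebra)
  then have "phi5 * sec 4 (eulersq * phi ^ 4) = phi5 * (- 25 * eulersq5 * phi5 ^ 4)" by algebra
  then show "sec 4 (eulersq * phi ^ 4) = - 25 * eulersq5 * phi5 ^ 4" by (rule cancel)
qed

section \<open>Negative powers and the five extractions\<close>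

definition iphi :: "int fps" where "iphi = recip phi"

lemma phi_iphi: "phi * iphi = 1"
  unfolding iphi_def by (rule recip_mult) (rule phi_nth_0)

text \<open>
  The quintic expresses an extraction at one power of \<open>phi\<close> through those at the next five powers,
  so starting from non-negative powers every negative power is reached. The polynomials in the
  following lemmas are the results of this recursion.
\<close>

lemma sec_quintic_recurrence:
  assumes "r < 5"
  shows "phi ^ 6 * sec r F = phi5 * sec r (F * phi ^ 5) - 5 * phi5\<^sup>2 * sec r (F * phi ^ 4)
   + (15 * phi5 ^ 3 - 5 * phi5 * phi\<^sup>2) * sec r (F * phi ^ 3)
   - (25 * phi5 ^ 4 - 15 * phi5\<^sup>2 * phi\<^sup>2) * sec r (F * phi\<^sup>2)
   + (25 * phi5 ^ 5 - 25 * phi5 ^ 3 * phi\<^sup>2 + 5 * phi5 * phi ^ 4) * sec r (F * phi)"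
proof -
  have "dil 5 (phi ^ 6) * F = dil 5 phi5 * (F * phi ^ 5) - dil 5 (5 * phi5\<^sup>2) * (F * phi ^ 4)
   + dil 5 (15 * phi5 ^ 3 - 5 * phi5 * phi\<^sup>2) * (F * phi ^ 3)
   - dil 5 (25 * phi5 ^ 4 - 15 * phi5\<^sup>2 * phi\<^sup>2) * (F * phi\<^sup>2)
   + dil 5 (25 * phi5 ^ 5 - 25 * phi5 ^ 3 * phi\<^sup>2 + 5 * phi5 * phi ^ 4) * (F * phi)"
    using phi_quintic unfolding phi0_eq
    by (simp only: dil_power dil_mult dil_add dil_diff dil_numeral zero_less_numeral) algebra
  from arg_cong[OF this, of "sec r"] show ?thesis
    by (simp only: sec_add sec_diff sec_dil_mult[OF assms])
qed

lemma phi_power_6_cancel: "phi ^ 6 * F = phi ^ 6 * G \<Longrightarrow> F = G"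
  using nonzero_if_nth_nonzero[of phi 0] by (simp add: phi_nth_0)

lemma sec4_eulersq_iphi: "sec 4 (eulersq * iphi) = 5 * eulersq5 * phi5 * iphi\<^sup>2"
proof (rule phi_power_6_cancel)
  have e: "eulersq * iphi * phi ^ 5 = eulersq * phi ^ 4" "eulersq * iphi * phi ^ 4 = eulersq * phi ^ 3"
    "eulersq * iphi * phi ^ 3 = eulersq * phi\<^sup>2" "eulersq * iphi * phi\<^sup>2 = eulersq * phi" "eulersq * iphi * phi = eulersq"
    using phi_iphi by algebra+
  show "phi ^ 6 * sec 4 (eulersq * iphi) = phi ^ 6 * (5 * eulersq5 * phi5 * iphi\<^sup>2)"
    using sec_quintic_recurrence[of 4 "eulersq * iphi"] sec4_eulersq_phi_powers phi_iphi
    unfolding e by simp algebra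
qed

lemma sec4_eulersq_iphi_2:
  "sec 4 (eulersq * iphi\<^sup>2) =
    eulersq5 * (125 * phi5 ^ 6 * iphi ^ 8 - 100 * phi5 ^ 4 * iphi ^ 6 + 30 * phi5\<^sup>2 * iphi ^ 4 - 4 * iphi\<^sup>2)"
proof (rule phi_power_6_cancel)
  have e: "eulersq * iphi\<^sup>2 * phi ^ 5 = eulersq * phi ^ 3" "eulersq * iphi\<^sup>2 * phi ^ 4 = eulersq * phi\<^sup>2"
    "eulersq * iphi\<^sup>2 * phi ^ 3 = eulersq * phi" "eulersq * iphi\<^sup>2 * phi\<^sup>2 = eulersq" "eulersq * iphi\<^sup>2 * phi = eulersq * iphi"
    using phi_iphi by algebra+
  show "phi ^ 6 * sec 4 (eulersq * iphi\<^sup>2) = phi ^ 6 *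
      (eulersq5 * (125 * phi5 ^ 6 * iphi ^ 8 - 100 * phi5 ^ 4 * iphi ^ 6 + 30 * phi5\<^sup>2 * iphi ^ 4 - 4 * iphi\<^sup>2))"
    using sec_quintic_recurrence[of 4 "eulersq * iphi\<^sup>2"] sec4_eulersq_phi_powers sec4_eulersq_iphi phi_iphi
    unfolding e by simp algebra
qed

lemma sec4_eulersq_iphi_3:
  "sec 4 (eulersq * iphi ^ 3) =
    eulersq5 * (3125 * phi5 ^ 11 * iphi ^ 14 - 5625 * phi5 ^ 9 * iphi ^ 12 + 3875 * phi5 ^ 7 * iphi ^ 10
      - 1475 * phi5 ^ 5 * iphi ^ 8 + 305 * phi5 ^ 3 * iphi ^ 6 - 20 * phi5 * iphi ^ 4)"
proof (rule phi_power_6_cancel)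
  have e: "eulersq * iphi ^ 3 * phi ^ 5 = eulersq * phi\<^sup>2" "eulersq * iphi ^ 3 * phi ^ 4 = eulersq * phi"
    "eulersq * iphi ^ 3 * phi ^ 3 = eulersq" "eulersq * iphi ^ 3 * phi\<^sup>2 = eulersq * iphi"
    "eulersq * iphi ^ 3 * phi = eulersq * iphi\<^sup>2"
    using phi_iphi by algebra+
  show "phi ^ 6 * sec 4 (eulersq * iphi ^ 3) = phi ^ 6 *
    (eulersq5 * (3125 * phi5 ^ 11 * iphi ^ 14 - 5625 * phi5 ^ 9 * iphi ^ 12 + 3875 * phi5 ^ 7 * iphi ^ 10
      - 1475 * phi5 ^ 5 * iphi ^ 8 + 305 * phi5 ^ 3 * iphi ^ 6 - 20 * phi5 * iphi ^ 4))"
    using sec_quintic_recurrence[of 4 "eulersq * iphi ^ 3"] sec4_eulersq_phi_powers sec4_eulersq_iphi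
      sec4_eulersq_iphi_2 phi_iphi
    unfolding e by simp algebra
qed

lemma sec0_iphi: "sec 0 iphi = 5 * phi5 ^ 5 * iphi ^ 6 - 5 * phi5 ^ 3 * iphi ^ 4 + phi5 * iphi\<^sup>2"
proof (rule phi_power_6_cancel)
  have e: "iphi * phi ^ 5 = phi ^ 4" "iphi * phi ^ 4 = phi ^ 3"
    "iphi * phi ^ 3 = phi\<^sup>2" "iphi * phi\<^sup>2 = phi" "iphi * phi = 1"
    using phi_iphi by algebra+
  show "phi ^ 6 * sec 0 iphi =
      phi ^ 6 * (5 * phi5 ^ 5 * iphi ^ 6 - 5 * phi5 ^ 3 * iphi ^ 4 + phi5 * iphi\<^sup>2)"
    using sec_quintic_recurrence[of 0 iphi] sec0_phi_powers phi_iphi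
    unfolding e by simp algebra
qed

lemma sec0_iphi_2:
  "sec 0 (iphi\<^sup>2) = 125 * phi5 ^ 10 * iphi ^ 12 - 250 * phi5 ^ 8 * iphi ^ 10
    + 175 * phi5 ^ 6 * iphi ^ 8 - 60 * phi5 ^ 4 * iphi ^ 6 + 11 * phi5\<^sup>2 * iphi ^ 4"
proof (rule phi_power_6_cancel)
  have e: "iphi\<^sup>2 * phi ^ 5 = phi ^ 3" "iphi\<^sup>2 * phi ^ 4 = phi\<^sup>2"
    "iphi\<^sup>2 * phi ^ 3 = phi" "iphi\<^sup>2 * phi\<^sup>2 = 1" "iphi\<^sup>2 * phi = iphi"
    using phi_iphi by algebra+
  show "phi ^ 6 * sec 0 (iphi\<^sup>2) = phi ^ 6 * (125 * phi5 ^ 10 * iphi ^ 12 - 250 * phi5 ^ 8 * iphi ^ 10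
    + 175 * phi5 ^ 6 * iphi ^ 8 - 60 * phi5 ^ 4 * iphi ^ 6 + 11 * phi5\<^sup>2 * iphi ^ 4)"
    using sec_quintic_recurrence[of 0 "iphi\<^sup>2"] sec0_phi_powers sec0_iphi phi_iphi
    unfolding e by simp algebra
qed

text \<open>
  Modulo 5 the quintic reads $\varphi(q^{25})\,\varphi(q)^5 \equiv \varphi(q^5)^6$.
\<close>

lemma iphi_power_5: "\<exists>H. iphi ^ 5 = dil 5 (phi5 * iphi ^ 6) + 5 * H"
proof -
  let ?j = "dil 5 iphi"
  have j: "phi5 * ?j = 1"
    using arg_cong[OF phi_iphi, of "dil 5"] by (simp add: dil_mult dil_one)
  let ?R = "(3 * phi0 ^ 3 - phi0 * phi5\<^sup>2) * phi ^ 3 - phi0\<^sup>2 * phi ^ 4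
   - (5 * phi0 ^ 4 - 3 * phi0\<^sup>2 * phi5\<^sup>2) * phi\<^sup>2
   + (5 * phi0 ^ 5 - 5 * phi0 ^ 3 * phi5\<^sup>2 + phi0 * phi5 ^ 4) * phi"
  have "phi0 * phi ^ 5 + 5 * ?R = phi5 ^ 6" using phi_quintic by algebra
  moreover have "phi ^ 5 * iphi ^ 5 = 1" "phi5 ^ 6 * ?j ^ 6 = 1"
    using phi_iphi j by (simp_all flip: power_mult_distrib)
  ultimately have "iphi ^ 5 = phi0 * ?j ^ 6 + 5 * (?R * iphi ^ 5 * ?j ^ 6)" by algebra
  then show ?thesis by (auto simp: phi0_eq dil_mult dil_power)
qed

text \<open>
  Write $d$ for \<open>phi5\<close>, $e$ for \<open>eulersq\<close>, $e_5$ for \<open>eulersq5\<close> and $i$ for \<open>iphi\<close>. Modulo 125 the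
  successive extractions are $5 e_5 d i^2$, then $5e\,(11 d^2 i^3 + 15 d^4 i^5)$, then
  $25 e_5 (d^3 i^4 + 3 d i^2)$, then $100\, e d^2 i^3$, and finally 0. Each extraction in the residue 4
  gains a factor 5, and those in the residue 0 lose none. The extractions from $i^4$ and $i^5$ are
  needed modulo 5 only, so \<open>iphi_power_5\<close> handles them.
\<close>

theorem five_sections:
  "\<exists>H. sec 4 (sec 0 (sec 4 (sec 0 (sec 4 (eulersq * iphi))))) = 125 * H"
proof -
  obtain H2 where H2: "iphi ^ 5 = dil 5 (phi5 * iphi ^ 6) + 5 * H2"
    using iphi_power_5 by blast
  have f1: "sec 4 (eulersq * iphi) = dil 5 (eulersq * phi) * (5 * iphi\<^sup>2)"
    unfolding sec4_eulersq_iphi by (simp add: dil_mult)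
  have "sec 0 (sec 4 (eulersq * iphi)) = eulersq * phi * (5 * sec 0 (iphi\<^sup>2))"
    unfolding f1 by (simp only: sec_dil_mult sec_numeral_mult zero_less_numeral)
  also have "\<dots> = 55 * phi5\<^sup>2 * (eulersq * iphi ^ 3) + 75 * phi5 ^ 4 * (eulersq * iphi ^ 5)
      + 125 * (eulersq * (5 * phi5 ^ 10 * iphi ^ 11 - 10 * phi5 ^ 8 * iphi ^ 9 + 7 * phi5 ^ 6 * iphi ^ 7
        - 3 * phi5 ^ 4 * iphi ^ 5))"
    unfolding sec0_iphi_2 using phi_iphi by algebra
  finally have "\<exists>H1. sec 0 (sec 4 (eulersq * iphi)) =
      55 * phi5\<^sup>2 * (eulersq * iphi ^ 3) + 75 * phi5 ^ 4 * (eulersq * iphi ^ 5) + 125 * H1"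
    by blast
  then obtain H1 where f2: "sec 0 (sec 4 (eulersq * iphi)) =
      dil 5 (55 * phi\<^sup>2) * (eulersq * iphi ^ 3) + dil 5 (75 * phi ^ 4) * (eulersq * iphi ^ 5) + 125 * H1"
    by (auto simp: dil_mult dil_power dil_numeral)
  \<comment> \<open>The factor $75 \equiv 0$ modulo 25 in front makes a congruence modulo 5 sufficient here.\<close>
  have v5: "sec 4 (eulersq * iphi ^ 5) = - (phi5 * iphi ^ 6 * eulersq5) + 5 * sec 4 (eulersq * H2)"
  proof -
    have "eulersq * iphi ^ 5 = dil 5 (phi5 * iphi ^ 6) * eulersq + 5 * (eulersq * H2)"
      unfolding H2 by algebra
    then show ?thesis
      by (simp only: sec_add sec_dil_mult sec_numeral_mult sec4_eulersq_phi_powers(1)) simp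
  qed
  let ?f3 = "sec 4 (sec 0 (sec 4 (eulersq * iphi)))"
  have "?f3 = 55 * phi\<^sup>2 * sec 4 (eulersq * iphi ^ 3) + 75 * phi ^ 4 * sec 4 (eulersq * iphi ^ 5) + 125 * sec 4 H1"
    unfolding f2 by (simp only: sec_add sec_dil_mult sec_numeral_mult)
  also have "\<dots> = 25 * eulersq5 * phi5 ^ 3 * iphi ^ 4 + 75 * eulersq5 * phi5 * iphi\<^sup>2 + 125 * (3 * phi ^ 4 * sec 4 (eulersq * H2) + sec 4 H1
        + eulersq5 * (1375 * phi5 ^ 11 * iphi ^ 12 - 2475 * phi5 ^ 9 * iphi ^ 10
          + 1705 * phi5 ^ 7 * iphi ^ 8 - 649 * phi5 ^ 5 * iphi ^ 6 + 134 * phi5 ^ 3 * iphi ^ 4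
          - 10 * phi5 * iphi\<^sup>2))"
    unfolding v5 sec4_eulersq_iphi_3 using phi_iphi by algebra
  finally have "\<exists>H3. ?f3 = 25 * eulersq5 * phi5 ^ 3 * iphi ^ 4 + 75 * eulersq5 * phi5 * iphi\<^sup>2 + 125 * H3"
    by blast
  then obtain H3 where f3: "?f3 =
      dil 5 (25 * eulersq * phi ^ 3) * iphi ^ 4 + dil 5 (75 * eulersq * phi) * iphi\<^sup>2 + 125 * H3"
    by (auto simp: dil_mult dil_power dil_numeral)
  \<comment> \<open>The factor 25 in front makes a congruence modulo 5 sufficient here.\<close>
  have u4: "sec 0 (iphi ^ 4) = phi5 * iphi ^ 6 * phi5 + 5 * sec 0 (phi * H2)"
  proof -
    have "iphi ^ 4 = phi * iphi ^ 5" using phi_iphi by algebra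
    also have "\<dots> = dil 5 (phi5 * iphi ^ 6) * phi + 5 * (phi * H2)" unfolding H2 by algebra
    finally have e: "iphi ^ 4 = dil 5 (phi5 * iphi ^ 6) * phi + 5 * (phi * H2)" .
    show ?thesis unfolding e
      by (simp only: sec_add sec_dil_mult sec_numeral_mult sec0_phi_powers zero_less_numeral)
  qed
  let ?f4 = "sec 0 ?f3"
  have "?f4 = 25 * eulersq * phi ^ 3 * sec 0 (iphi ^ 4) + 75 * eulersq * phi * sec 0 (iphi\<^sup>2) + 125 * sec 0 H3"
    unfolding f3 by (simp only: sec_add sec_dil_mult sec_numeral_mult zero_less_numeral)
  also have "\<dots> = 100 * phi5\<^sup>2 * (eulersq * iphi ^ 3) + 125 * (sec 0 H3 + eulersq * phi ^ 3 * sec 0 (phi * H2)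
      + 3 * eulersq * (25 * phi5 ^ 10 * iphi ^ 11 - 50 * phi5 ^ 8 * iphi ^ 9
        + 35 * phi5 ^ 6 * iphi ^ 7 - 12 * phi5 ^ 4 * iphi ^ 5 + 2 * phi5\<^sup>2 * iphi ^ 3))"
    unfolding u4 sec0_iphi_2 using phi_iphi by algebra
  finally have "\<exists>H4. ?f4 = 100 * phi5\<^sup>2 * (eulersq * iphi ^ 3) + 125 * H4" by blast
  then obtain H4 where f4: "?f4 = dil 5 (100 * phi\<^sup>2) * (eulersq * iphi ^ 3) + 125 * H4"
    by (auto simp: dil_mult dil_power dil_numeral)
  have "sec 4 ?f4 = 100 * phi\<^sup>2 * sec 4 (eulersq * iphi ^ 3) + 125 * sec 4 H4"
    unfolding f4 by (simp only: sec_add sec_dil_mult sec_numeral_mult)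
  also have "\<dots> = 125 * (sec 4 H4 + 4 * phi\<^sup>2 * (eulersq5 * (625 * phi5 ^ 11 * iphi ^ 14 - 1125 * phi5 ^ 9 * iphi ^ 12
      + 775 * phi5 ^ 7 * iphi ^ 10 - 295 * phi5 ^ 5 * iphi ^ 8 + 61 * phi5 ^ 3 * iphi ^ 6 - 4 * phi5 * iphi ^ 4)))"
    unfolding sec4_eulersq_iphi_3 by algebra
  finally show ?thesis by blast
qed

corollary eulersq_iphi_coeff: "125 dvd fps_nth (eulersq * iphi) (3125 * n + 2604)"
proof -
  obtain H where "sec 4 (sec 0 (sec 4 (sec 0 (sec 4 (eulersq * iphi))))) = 125 * H"
    using five_sections by blast
  from arg_cong[OF this, of "\<lambda>F. fps_nth F n"]
  have "fps_nth (eulersq * iphi) (3125 * n + 2604) = 125 * fps_nth H n"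
    by (simp add: sec_nth numeral_fps_const add.commute)
  then show ?thesis by simp
qed

section \<open>Sums of power series\<close>

text \<open>
  The sum of a sequence of series whose \<open>n\<close>-th term is divisible by \<open>fps_X ^ n\<close>.
\<close>

definition fsum :: "(nat \<Rightarrow> int fps) \<Rightarrow> int fps" where
  "fsum f = Abs_fps (\<lambda>k. \<Sum>n\<le>k. fps_nth (f n) k)"

lemma fsum_cong_dvd:
  assumes "\<And>n. fps_X ^ k dvd f n - g n"
  shows "fps_X ^ k dvd fsum f - fsum g"
  using assms unfolding fps_X_power_dvd_iff fsum_def by simp

lemma fsum_trunc:
  assumes "\<And>n. fps_X ^ n dvd f n"
  shows "fps_X ^ k dvd fsum f - (\<Sum>n<k. f n)"
  unfolding fps_X_power_dvd_iff
proof (intro allI impI)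
  fix i assume "i < k"
  have "(\<Sum>n<k. fps_nth (f n) i) = (\<Sum>n\<le>i. fps_nth (f n) i)"
    by (rule sum.mono_neutral_right) (use \<open>i < k\<close> assms in \<open>auto simp: fps_X_power_dvd_iff\<close>)
  then show "fps_nth (fsum f - (\<Sum>n<k. f n)) i = 0" by (simp add: fsum_def fps_sum_nth)
qed

lemma fsum_unique:
  assumes "\<And>n. fps_X ^ n dvd f n" "\<And>k. fps_X ^ k dvd F - (\<Sum>n<k. f n)"
  shows "F = fsum f"
proof (rule fps_eq_if_dvd_all)
  fix k show "fps_X ^ k dvd F - fsum f"
    using dvd_diff[OF assms(2)[of k] fsum_trunc[OF assms(1), of k]] by simp
qed

lemma fsum_add: "fsum (\<lambda>n. f n + g n) = fsum f + fsum g"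
  by (rule fps_ext) (simp add: fsum_def sum.distrib)

lemma fsum_mult:
  assumes "\<And>n. fps_X ^ n dvd f n"
  shows "c * fsum f = fsum (\<lambda>n. c * f n)"
proof (rule fsum_unique)
  fix k
  have "c * fsum f - (\<Sum>n<k. c * f n) = c * (fsum f - (\<Sum>n<k. f n))"
    by (simp add: right_diff_distrib sum_distrib_left)
  then show "fps_X ^ k dvd c * fsum f - (\<Sum>n<k. c * f n)"
    using fsum_trunc[OF assms] by simp
qed (use assms in simp)

lemma fsum_shift:
  assumes "\<And>n. fps_X ^ n dvd f n"
  shows "fsum f = f 0 + fsum (\<lambda>n. f (Suc n))"
proof -
  have "fsum f - f 0 = fsum (\<lambda>n. f (Suc n))"
  proof (rule fsum_unique)
    show "fps_X ^ n dvd f (Suc n)" for n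
      using assms[of "Suc n"] by (meson dvd_trans le_imp_power_dvd le_SucI order_refl)
    fix k
    have "fps_X ^ k dvd fsum f - (\<Sum>n<Suc k. f n)"
      using fsum_trunc[OF assms, of "Suc k"] by (meson dvd_trans le_imp_power_dvd le_SucI order_refl)
    then show "fps_X ^ k dvd fsum f - f 0 - (\<Sum>n<k. f (Suc n))"
      unfolding sum.lessThan_Suc_shift by (simp add: algebra_simps)
  qed
  then show ?thesis by (simp add: algebra_simps)
qed

text \<open>
  This identifies \<open>fsum\<close> with the topological sum in the definition of \<open>nu\<close>.
\<close>

lemma fsum_sums:
  assumes "\<And>n. fps_X ^ n dvd f n"
  shows "f sums fsum f"
  unfolding sums_def
proof (rule tendsto_fpsI)
  fix k
  have "fps_nth (\<Sum>n<N. f n) k = fps_nth (fsum f) k" if "k + 1 \<le> N" for N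
    using fsum_trunc[OF assms, of N] that unfolding fps_X_power_dvd_iff by auto
  then show "\<forall>\<^sub>F N in sequentially. fps_nth (\<Sum>n<N. f n) k = fps_nth (fsum f) k"
    unfolding eventually_sequentially by blast
qed

lemma X_power_dvd_X_power: "k \<le> n \<Longrightarrow> fps_X ^ k dvd (fps_X :: int fps) ^ n * F"
  by (meson dvd_mult2 le_imp_power_dvd)

lemma X_power_merge: "(fps_X :: int fps) ^ a * (1 + fps_X ^ b) * F = fps_X ^ a * F + fps_X ^ (a + b) * F"
  by (simp add: algebra_simps power_add)

section \<open>The even part of the mock theta series\<close>

text \<open>
  The products $(q;q^2)_n$ and $(-q;q^2)_n$, and their inverses.
\<close>

abbreviation "podd \<equiv> qpoch fps_X (fps_X\<^sup>2) :: nat \<Rightarrow> int fps"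
abbreviation "modd \<equiv> qpoch (- fps_X) (fps_X\<^sup>2) :: nat \<Rightarrow> int fps"
definition rpodd :: "nat \<Rightarrow> int fps" where "rpodd n = recip (podd n)"
definition rmodd :: "nat \<Rightarrow> int fps" where "rmodd n = recip (modd n)"

lemma podd_rpodd: "podd n * rpodd n = 1" and modd_rmodd: "modd n * rmodd n = 1"
  unfolding rpodd_def rmodd_def by (rule qpoch_recip; simp)+

lemma podd_Suc: "podd (Suc n) = podd n * (1 - fps_X ^ (2 * n + 1))"
  and modd_Suc: "modd (Suc n) = modd n * (1 + fps_X ^ (2 * n + 1))"
  by (simp_all add: qpoch_Suc power_mult)

lemma inverse_factor: "r = t * r'" if "P * r = 1" "P * t * r' = 1" for P r t r' :: "int fps"
proof -
  have "r = r * (P * t * r')" using that by simp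
  also have "\<dots> = (P * r) * (t * r')" by (simp only: mult_ac)
  finally show ?thesis using that by simp
qed

lemma rpodd_Suc: "rpodd n = (1 - fps_X ^ (2 * n + 1)) * rpodd (Suc n)"
  by (rule inverse_factor[OF podd_rpodd podd_rpodd[of "Suc n", unfolded podd_Suc]])

lemma rmodd_Suc: "rmodd n = (1 + fps_X ^ (2 * n + 1)) * rmodd (Suc n)"
  by (rule inverse_factor[OF modd_rmodd modd_rmodd[of "Suc n", unfolded modd_Suc]])

lemma nu_eq_fsum:
  "nu fps_X = fsum (\<lambda>n. fps_X ^ (n * (n + 1)) * rmodd (n + 1))"
  "nu (- fps_X) = fsum (\<lambda>n. fps_X ^ (n * (n + 1)) * rpodd (n + 1))"
  unfolding nu_minus_X nu_def[of fps_X] rmodd_def rpodd_def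
  by (rule sums_unique [symmetric], rule fsum_sums, rule X_power_dvd_X_power, simp)+

text \<open>
  The series $A(z) = \sum_n z^n (-q;q^2)_n$ satisfies $(1-z) A(z) = 1 + z q A(z q^2)$. Iterating this from
  $z = q$ produces the terms $q^{k(k+1)}/(q;q^2)_{k+1}$ of $\nu(-q)$ one after the other.
\<close>

lemma nu_minus_X_eq: "nu (- fps_X) = fsum (\<lambda>n. fps_X ^ n * modd n)"
proof -
  define A where "A = (\<lambda>k. fsum (\<lambda>n. fps_X ^ ((2 * k + 1) * n) * modd n))"
  have rec: "(1 - fps_X ^ (2 * k + 1)) * A k = 1 + fps_X ^ (2 * k + 2) * A (Suc k)" for k
  proof -
    have ord: "fps_X ^ n dvd fps_X ^ ((2 * k + 1) * n) * modd n" for k n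
      by (rule X_power_dvd_X_power) simp
    have "A k = 1 + fsum (\<lambda>n. fps_X ^ ((2 * k + 1) * Suc n) * modd (Suc n))"
      unfolding A_def by (subst fsum_shift[OF ord]) simp
    also have "(\<lambda>n. fps_X ^ ((2 * k + 1) * Suc n) * modd (Suc n)) =
        (\<lambda>n. fps_X ^ (2 * k + 1) * (fps_X ^ ((2 * k + 1) * n) * modd n) +
          fps_X ^ (2 * k + 2) * (fps_X ^ ((2 * Suc k + 1) * n) * modd n))"
    proof
      fix n
      have e: "(2 * k + 1) * Suc n + (2 * n + 1) = (2 * k + 2) + (2 * Suc k + 1) * n"
        "(2 * k + 1) * Suc n = (2 * k + 1) + (2 * k + 1) * n"
        by simp_all
      have "fps_X ^ ((2 * k + 1) * Suc n) * modd (Suc n) =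
          fps_X ^ ((2 * k + 1) * Suc n) * (1 + fps_X ^ (2 * n + 1)) * modd n"
        unfolding modd_Suc by (simp only: mult_ac)
      also have "\<dots> = fps_X ^ ((2 * k + 1) * Suc n) * modd n +
          fps_X ^ (2 * k + 2) * (fps_X ^ ((2 * Suc k + 1) * n) * modd n)"
        unfolding X_power_merge e(1) power_add[of _ "2 * k + 2"] by (simp only: mult.assoc)
      also have "fps_X ^ ((2 * k + 1) * Suc n) * modd n =
          fps_X ^ (2 * k + 1) * (fps_X ^ ((2 * k + 1) * n) * modd n)"
        unfolding e(2) power_add by (simp only: mult.assoc)
      finally show "fps_X ^ ((2 * k + 1) * Suc n) * modd (Suc n) =
          fps_X ^ (2 * k + 1) * (fps_X ^ ((2 * k + 1) * n) * modd n) +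
          fps_X ^ (2 * k + 2) * (fps_X ^ ((2 * Suc k + 1) * n) * modd n)" .
    qed
    also have "fsum \<dots> = fps_X ^ (2 * k + 1) * A k + fps_X ^ (2 * k + 2) * A (Suc k)"
      unfolding A_def by (simp only: fsum_add fsum_mult[OF ord])
    finally have "A k = 1 + (fps_X ^ (2 * k + 1) * A k + fps_X ^ (2 * k + 2) * A (Suc k))" .
    moreover have "(1 - z) * a = 1 + w" if "a = 1 + (z * a + w)" for a z w :: "int fps"
      using that by algebra
    ultimately show ?thesis by blast
  qed
  have "A 0 = (\<Sum>j<k. fps_X ^ (j * (j + 1)) * rpodd (j + 1)) + fps_X ^ (k * (k + 1)) * rpodd k * A k" for k
  proof (induction k)
    case 0
    have "rpodd 0 = 1" using podd_rpodd[of 0] by simp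
    then show ?case by simp
  next
    case (Suc k)
    have e: "k * (k + 1) + (2 * k + 2) = Suc k * (Suc k + 1)" by simp
    have "fps_X ^ (k * (k + 1)) * rpodd k * A k =
        fps_X ^ (k * (k + 1)) * rpodd (Suc k) * ((1 - fps_X ^ (2 * k + 1)) * A k)"
      by (subst rpodd_Suc) (simp only: mult_ac)
    also have "\<dots> = fps_X ^ (k * (k + 1)) * rpodd (Suc k) +
        fps_X ^ (k * (k + 1) + (2 * k + 2)) * rpodd (Suc k) * A (Suc k)"
    proof -
      have "w * r * (1 + y * a) = w * r + w * y * r * a" for w r y a :: "int fps" by algebra
      then show ?thesis unfolding rec power_add[of fps_X "k * (k + 1)" "2 * k + 2"] .
    qed
    finally show ?case using Suc unfolding e by (simp add: add.assoc)
  qed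
  note A0 = this
  have "A 0 = fsum (\<lambda>n. fps_X ^ (n * (n + 1)) * rpodd (n + 1))"
  proof (rule fsum_unique)
    show "fps_X ^ n dvd fps_X ^ (n * (n + 1)) * rpodd (n + 1)" for n
      by (rule X_power_dvd_X_power) simp
    show "fps_X ^ k dvd A 0 - (\<Sum>j<k. fps_X ^ (j * (j + 1)) * rpodd (j + 1))" for k
      by (subst A0[of k]) (simp add: X_power_dvd_X_power mult.assoc)
  qed
  then show ?thesis unfolding nu_eq_fsum by (simp add: A_def)
qed

text \<open>
  The terms of the bilateral series
  $N_m = \sum_{n \in \mathbb{Z}} q^{n(n+1)}/(-q;q^2)_{n+m+1}$: \<open>uterm m n\<close> is the term with index \<open>n\<close>, and \<open>vterm m i\<close>
  the one with index $-1-i$. For $i > m$ the product has negative length, so its reciprocal is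
  $q^{-(i-m)^2} (-q;q^2)_{i-m}$, which combines with $q^{i(i+1)}$ to the stated power.
\<close>

definition uterm :: "nat \<Rightarrow> nat \<Rightarrow> int fps" where
  "uterm m n = fps_X ^ (n * (n + 1)) * rmodd (n + m + 1)"

definition vterm :: "nat \<Rightarrow> nat \<Rightarrow> int fps" where
  "vterm m i = (if i \<le> m then fps_X ^ (i * (i + 1)) * rmodd (m - i)
     else fps_X ^ (m * m + 3 * m + 1 + (i - Suc m) * (2 * m + 1)) * modd (i - m))"

lemma uterm_order: "fps_X ^ n dvd uterm m n"
  unfolding uterm_def by (rule X_power_dvd_X_power) simp

lemma vterm_order: "fps_X ^ i dvd vterm m i"
proof (cases "i \<le> m")
  case True
  then show ?thesis unfolding vterm_def by (simp add: X_power_dvd_X_power)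
next
  case False
  have "i - Suc m \<le> (i - Suc m) * (2 * m + 1)" by simp
  then have "i \<le> m * m + 3 * m + 1 + (i - Suc m) * (2 * m + 1)" using False by linarith
  then show ?thesis using False unfolding vterm_def by (simp add: X_power_dvd_X_power)
qed

text \<open>
  With $t_m(n)$ the \<open>n\<close>-th term of $N_m$, one has $t_m(n) = t_{m+1}(n) + q^{2m+1} t_m(n+1)$ for all integers \<open>n\<close>:
  multiply the denominator of $t_m(n)$ by its next factor. The next two lemmas are the same
  identity for $n = -1$ and for $n < -1$.
\<close>

lemma uterm_rec: "uterm m n = uterm (Suc m) n + fps_X ^ (2 * m + 1) * uterm m (Suc n)"
proof -
  have e: "n * (n + 1) + (2 * (n + m + 1) + 1) = (2 * m + 1) + Suc n * (Suc n + 1)" by simp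
  have "uterm m n = fps_X ^ (n * (n + 1)) * (1 + fps_X ^ (2 * (n + m + 1) + 1)) * rmodd (Suc (n + m + 1))"
    unfolding uterm_def by (subst rmodd_Suc) (simp only: mult.assoc)
  also have "\<dots> = fps_X ^ (n * (n + 1)) * rmodd (Suc (n + m + 1)) +
      fps_X ^ (2 * m + 1) * (fps_X ^ (Suc n * (Suc n + 1)) * rmodd (Suc (n + m + 1)))"
    unfolding X_power_merge e power_add[of _ "2 * m + 1"] by (simp only: mult.assoc)
  finally show ?thesis by (simp add: uterm_def)
qed

lemma vterm_rec_0: "vterm m 0 = vterm (Suc m) 0 + fps_X ^ (2 * m + 1) * uterm m 0"
  unfolding vterm_def uterm_def by (subst rmodd_Suc) (simp add: algebra_simps)

lemma vterm_rec: "vterm m (Suc i) = vterm (Suc m) (Suc i) + fps_X ^ (2 * m + 1) * vterm m i"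
proof -
  consider "Suc i \<le> m" | "i = m" | "i > m" by linarith
  then show ?thesis
  proof cases
    case 1
    then obtain l where l: "m = Suc i + l" using le_Suc_ex by blast
    have e: "Suc i * (Suc i + 1) + (2 * l + 1) = (2 * m + 1) + i * (i + 1)" using l by simp
    have "vterm m (Suc i) = fps_X ^ (Suc i * (Suc i + 1)) * (1 + fps_X ^ (2 * l + 1)) * rmodd (Suc l)"
      using l unfolding vterm_def by (subst rmodd_Suc) (simp add: mult.assoc)
    also have "\<dots> = fps_X ^ (Suc i * (Suc i + 1)) * rmodd (Suc l) +
        fps_X ^ (2 * m + 1) * (fps_X ^ (i * (i + 1)) * rmodd (Suc l))"
      unfolding X_power_merge e power_add[of _ "2 * m + 1"] by (simp only: mult.assoc)
    finally show ?thesis using l by (simp add: vterm_def Suc_diff_le)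
  next
    case 2
    have r: "rmodd 0 = 1" using modd_rmodd[of 0] by simp
    have e: "(m * m + 3 * m + 1) + 1 = Suc m * (Suc m + 1)"
      "m * m + 3 * m + 1 = (2 * m + 1) + m * (m + 1)" by simp_all
    have "vterm m (Suc i) = fps_X ^ (m * m + 3 * m + 1) * (1 + fps_X ^ 1) * 1"
      using 2 by (simp add: vterm_def modd_Suc)
    also have "\<dots> = fps_X ^ (m * m + 3 * m + 1) + fps_X ^ (Suc m * (Suc m + 1))"
      unfolding X_power_merge e(1) by simp
    also have "fps_X ^ (m * m + 3 * m + 1) = (fps_X :: int fps) ^ (2 * m + 1) * fps_X ^ (m * (m + 1))"
      unfolding e(2) by (rule power_add)
    finally show ?thesis using 2 r by (simp add: vterm_def)
  next
    case 3
    then obtain l where l: "i = Suc m + l" using less_imp_Suc_add by fastforce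
    let ?a = "m * m + 3 * m + 1 + Suc l * (2 * m + 1)"
    have e: "?a + (2 * Suc l + 1) = Suc m * Suc m + 3 * Suc m + 1 + l * (2 * Suc m + 1)"
      "?a = (2 * m + 1) + (m * m + 3 * m + 1 + l * (2 * m + 1))" by simp_all
    have "vterm m (Suc i) = fps_X ^ ?a * (1 + fps_X ^ (2 * Suc l + 1)) * modd (Suc l)"
    proof -
      have "Suc i - m = Suc (Suc l)" "Suc i - Suc m = Suc l" "\<not> Suc i \<le> m" using l by simp_all
      then show ?thesis unfolding vterm_def by (simp only: if_False modd_Suc[of "Suc l"] mult_ac)
    qed
    also have "\<dots> = fps_X ^ (2 * m + 1) * (fps_X ^ (m * m + 3 * m + 1 + l * (2 * m + 1)) * modd (Suc l)) +
        fps_X ^ (Suc m * Suc m + 3 * Suc m + 1 + l * (2 * Suc m + 1)) * modd (Suc l)"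
      unfolding X_power_merge e(1) unfolding e(2) power_add[of _ "2 * m + 1"] by (simp only: mult.assoc)
    also have "\<dots> = fps_X ^ (2 * m + 1) * vterm m i + vterm (Suc m) (Suc i)"
      using l by (simp add: vterm_def)
    finally show ?thesis by simp
  qed
qed

definition bilateral :: "nat \<Rightarrow> int fps" where
  "bilateral m = fsum (uterm m) + fsum (vterm m)"

text \<open>
  Sum the term recurrence over all integers; the shift of the index leaves the sum unchanged.
\<close>

lemma bilateral_Suc: "bilateral (Suc m) = (1 - fps_X ^ (2 * m + 1)) * bilateral m"
proof -
  let ?z = "fps_X ^ (2 * m + 1) :: int fps"
  have ord: "fps_X ^ n dvd uterm m (Suc n)" for n
    using uterm_order[of "Suc n" m] by (meson dvd_trans le_imp_power_dvd le_SucI order_refl)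
  have "fsum (uterm m) = fsum (\<lambda>n. uterm (Suc m) n + ?z * uterm m (Suc n))"
    by (rule arg_cong[where f = fsum], rule ext, rule uterm_rec)
  moreover have "fsum (\<lambda>n. uterm m (Suc n)) = fsum (uterm m) - uterm m 0"
    using fsum_shift[OF uterm_order[of _ m]] by simp
  ultimately have u: "fsum (uterm m) = fsum (uterm (Suc m)) + ?z * (fsum (uterm m) - uterm m 0)"
    unfolding fsum_add fsum_mult[OF ord, symmetric] by (simp only:)
  have "fsum (vterm m) = vterm m 0 + fsum (\<lambda>i. vterm m (Suc i))"
    by (rule fsum_shift[OF vterm_order[of _ m]])
  also have "\<dots> = vterm (Suc m) 0 + ?z * uterm m 0 +
      fsum (\<lambda>i. vterm (Suc m) (Suc i) + ?z * vterm m i)"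
    unfolding vterm_rec_0[of m] vterm_rec[of m] ..
  also have "\<dots> = fsum (vterm (Suc m)) + ?z * (uterm m 0 + fsum (vterm m))"
  proof -
    have "fsum (\<lambda>i. vterm (Suc m) (Suc i)) = fsum (vterm (Suc m)) - vterm (Suc m) 0"
      using fsum_shift[OF vterm_order[of _ "Suc m"]] by simp
    then show ?thesis
      unfolding fsum_add fsum_mult[OF vterm_order[of _ m], symmetric] by (simp add: distrib_left)
  qed
  finally have v: "fsum (vterm m) = fsum (vterm (Suc m)) + ?z * (uterm m 0 + fsum (vterm m))" .
  have "U' + V' = (1 - z) * (U + V)" if "U = U' + z * (U - u)" "V = V' + z * (u + V)"
    for U V U' V' z u :: "int fps"
    using that by algebra
  from this[OF u v] show ?thesis unfolding bilateral_def .
qed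

lemma bilateral_eq: "bilateral m = podd m * bilateral 0"
  by (induction m) (simp_all add: bilateral_Suc podd_Suc mult_ac)

text \<open>
  This is $\psi(q^2)$ for Gauss's series $\psi(q) = \sum_n q^{n(n+1)/2}$.
\<close>

definition pronic :: "int fps" where
  "pronic = fsum (\<lambda>n. fps_X ^ (n * (n + 1)))"

lemma rmodd_limit:
  assumes "k \<le> n"
  shows "fps_X ^ k dvd rmodd n - recip (qinf (- fps_X) (fps_X\<^sup>2))"
proof -
  let ?M = "qinf (- fps_X) (fps_X\<^sup>2)"
  have M: "?M * recip ?M = 1" by (intro recip_mult qinf_nth_0) simp
  have "r - R = r * R * (M - m)" if "m * r = 1" "M * R = 1" for m r M R :: "int fps"
    using that by algebra
  from this[OF modd_rmodd M]
  have "rmodd n - recip ?M = rmodd n * recip ?M * (?M - modd n)" .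
  moreover have "fps_X ^ k dvd ?M - modd n"
    using assms by (intro qinf_trunc') simp_all
  ultimately show ?thesis by simp
qed

text \<open>
  For large \<open>m\<close> every denominator of $N_m$ is close to $(-q;q^2)_\infty$, except where the power of $q$
  in the numerator is already high. The integers \<open>n\<close> and $-1-n$ contribute the same power, whence the factor 2.
\<close>

lemma bilateral_limit:
  "fps_X ^ m dvd bilateral m - 2 * recip (qinf (- fps_X) (fps_X\<^sup>2)) * pronic"
proof -
  let ?R = "recip (qinf (- fps_X) (fps_X\<^sup>2))"
  let ?t = "\<lambda>n. ?R * fps_X ^ (n * (n + 1))"
  have ord: "fps_X ^ n dvd fps_X ^ (n * (n + 1))" for n
    by (rule le_imp_power_dvd) simp
  have "fps_X ^ m dvd uterm m n - ?t n" for n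
  proof -
    have "uterm m n - ?t n = fps_X ^ (n * (n + 1)) * (rmodd (n + m + 1) - ?R)"
      by (simp add: uterm_def right_diff_distrib mult.commute)
    then show ?thesis using rmodd_limit[of m "n + m + 1"] by simp
  qed
  then have 1: "fps_X ^ m dvd fsum (uterm m) - fsum ?t" by (rule fsum_cong_dvd)
  have "fps_X ^ m dvd vterm m i - ?t i" for i
  proof (cases "i \<le> m")
    case True
    have "vterm m i - ?t i = fps_X ^ (i * (i + 1)) * (rmodd (m - i) - ?R)"
      using True by (simp add: vterm_def right_diff_distrib mult.commute)
    moreover have "fps_X ^ (i * (i + 1) + (m - i)) dvd fps_X ^ (i * (i + 1)) * (rmodd (m - i) - ?R)"
      unfolding power_add by (intro mult_dvd_mono rmodd_limit) simp_all
    moreover have "fps_X ^ m dvd (fps_X :: int fps) ^ (i * (i + 1) + (m - i))"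
      by (rule le_imp_power_dvd) simp
    ultimately show ?thesis by (simp only: dvd_trans)
  next
    case False
    then have "fps_X ^ m dvd (fps_X :: int fps) ^ i" by (intro le_imp_power_dvd) simp
    from dvd_trans[OF this vterm_order] dvd_mult[OF dvd_trans[OF this ord]]
    show ?thesis by (rule dvd_diff)
  qed
  then have 2: "fps_X ^ m dvd fsum (vterm m) - fsum ?t" by (rule fsum_cong_dvd)
  have "fsum ?t = ?R * pronic"
    unfolding pronic_def by (rule fsum_mult[OF ord, symmetric])
  then show ?thesis
    using dvd_add[OF 1 2] by (simp add: bilateral_def algebra_simps)
qed

text \<open>
  The terms of negative index of $N_0$ are $q^i (-q;q^2)_i$, which sum to $\nu(-q)$ by
  \<open>nu_minus_X_eq\<close>.
\<close>

lemma nu_sum_eq_bilateral: "nu fps_X + nu (- fps_X) = bilateral 0"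
proof -
  have "vterm 0 = (\<lambda>i. fps_X ^ i * modd i)"
  proof
    fix i show "vterm 0 i = fps_X ^ i * modd i"
      using modd_rmodd[of 0] by (cases i) (simp_all add: vterm_def)
  qed
  moreover have "uterm 0 = (\<lambda>n. fps_X ^ (n * (n + 1)) * rmodd (n + 1))"
    by (rule ext) (simp add: uterm_def)
  ultimately show ?thesis
    unfolding bilateral_def nu_minus_X_eq nu_eq_fsum(1) by (simp only:)
qed

lemma nu_sum_times:
  "(nu fps_X + nu (- fps_X)) * qinf (fps_X\<^sup>2) (fps_X ^ 4) = 2 * pronic"
proof -
  let ?M = "qinf (- fps_X) (fps_X\<^sup>2)" and ?O = "qinf fps_X (fps_X\<^sup>2)"
  have M: "?M * recip ?M = 1" by (intro recip_mult qinf_nth_0) simp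
  have "?O * bilateral 0 = 2 * recip ?M * pronic"
  proof (rule fps_eq_if_dvd_all)
    fix k
    have "fps_X ^ k dvd ?O * bilateral 0 - podd k * bilateral 0"
      by (intro dvd_diff_mult qinf_trunc) simp_all
    from dvd_add[OF this bilateral_limit[of k, unfolded bilateral_eq[of k]]]
    show "fps_X ^ k dvd ?O * bilateral 0 - 2 * recip ?M * pronic" by simp
  qed
  then have "(?O * ?M) * bilateral 0 = 2 * pronic" using M by algebra
  moreover have "?O * ?M = qinf (fps_X\<^sup>2) (fps_X ^ 4)"
    using qinf_mult_minus[of "fps_X\<^sup>2" fps_X] by simp
  ultimately show ?thesis unfolding nu_sum_eq_bilateral by (simp add: mult.commute)
qed

text \<open>
  The triple product with $x = q^2$ and $y = 1$ counts each pronic exponent twice; the factor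
  $1 - (-1) = 2$ of $(-1;q^2)_\infty$ accounts for this.
\<close>

lemma pronic_eq_qinf: "pronic = (qinf (- (fps_X\<^sup>2)) (fps_X\<^sup>2))\<^sup>2 * qinf (fps_X\<^sup>2) (fps_X\<^sup>2)"
proof -
  let ?B = "qinf (- (fps_X\<^sup>2)) (fps_X\<^sup>2)"
  let ?q = "fps_X\<^sup>2 :: int fps"
  have t: "theta_term ?q 1 ?q j = fps_X ^ (nat j * (nat j + 1))" if "j \<ge> 0" for j
  proof -
    have "2 * n + 2 * (n choose 2) = n * (n + 1)" for n
      by (induction n) (auto simp: Suc_choose_2 binomial_eq_0)
    then show ?thesis
      using that by (simp add: theta_term_def flip: power_mult power_add)
  qed
  have t': "theta_term ?q 1 ?q (- j) = theta_term ?q 1 ?q (j - 1)" if j: "j \<ge> 1" for j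
  proof -
    obtain n where "j = 1 + int n" using j zle_iff_zadd[of 1 j] by blast
    then have n: "j = int (Suc n)" "j - 1 = int n" by simp_all
    have "theta_term ?q 1 ?q (- int (Suc n)) = ?q ^ (Suc n choose 2)"
      unfolding theta_term_def by (simp del: of_nat_Suc)
    moreover have "theta_term ?q 1 ?q (int n) = ?q ^ n * ?q ^ (n choose 2)"
      unfolding theta_term_def by simp
    ultimately show ?thesis
      unfolding n(2) unfolding n(1) by (simp only: Suc_choose_2 power_add mult.commute)
  qed
  have "2 * (?B\<^sup>2 * qinf ?q ?q) = 2 * pronic"
  proof (rule fps_eq_if_dvd_all)
    fix k
    let ?S = "\<Sum>n<k. (fps_X :: int fps) ^ (n * (n + 1))"
    have "qinf (- 1) ?q = 2 * ?B" using qinf_shift[of ?q "- 1"] by simp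
    then have pr: "2 * (?B\<^sup>2 * qinf ?q ?q) = qinf (- ?q) ?q * qinf (- 1) ?q * qinf ?q ?q"
      by (simp add: power2_eq_square mult_ac)
    have 1: "fps_X ^ k dvd 2 * (?B\<^sup>2 * qinf ?q ?q) - (\<Sum>j\<in>{- int k..int k}. theta_term ?q 1 ?q j)"
      unfolding pr by (rule triple_product) simp_all
    have "{- int k..int k} = {- int k..<0} \<union> {0..int k}" by auto
    then have "(\<Sum>j\<in>{- int k..int k}. theta_term ?q 1 ?q j) =
        (\<Sum>j\<in>{- int k..<0}. theta_term ?q 1 ?q j) + (\<Sum>j\<in>{0..int k}. theta_term ?q 1 ?q j)"
      by (simp only:) (rule sum.union_disjoint, auto)
    also have "(\<Sum>j\<in>{- int k..<0}. theta_term ?q 1 ?q j) = ?S"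
    proof (rule sum.reindex_bij_witness[of _ "\<lambda>n. - int (Suc n)" "\<lambda>j. nat (- j - 1)"])
      fix j assume "j \<in> {- int k..<0}"
      then have "theta_term ?q 1 ?q j = theta_term ?q 1 ?q (- j - 1)" "- j - 1 \<ge> 0"
        using t'[of "- j"] by simp_all
      then show "fps_X ^ (nat (- j - 1) * (nat (- j - 1) + 1)) = theta_term ?q 1 ?q j"
        using t[of "- j - 1"] by simp
    qed auto
    also have "(\<Sum>j\<in>{0..int k}. theta_term ?q 1 ?q j) = (\<Sum>n<Suc k. fps_X ^ (n * (n + 1)))"
    proof (rule sum.reindex_bij_witness[of _ int nat])
      fix j assume "j \<in> {0..int k}"
      then show "fps_X ^ (nat j * (nat j + 1)) = theta_term ?q 1 ?q j" by (simp only: t atLeastAtMost_iff)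
    qed auto
    finally have s: "(\<Sum>j\<in>{- int k..int k}. theta_term ?q 1 ?q j) = 2 * ?S + fps_X ^ (k * (k + 1))"
      by simp
    have "fps_X ^ k dvd pronic - ?S"
      unfolding pronic_def by (rule fsum_trunc, rule le_imp_power_dvd) simp
    moreover have "fps_X ^ k dvd (fps_X :: int fps) ^ (k * (k + 1))"
      by (rule le_imp_power_dvd) simp
    ultimately have 2: "fps_X ^ k dvd 2 * (pronic - ?S) - fps_X ^ (k * (k + 1))"
      by (rule dvd_diff[OF dvd_mult])
    have "L - (2 * S + x) - (2 * (P - S) - x) = L - 2 * P" for L S x P :: "int fps"
      by (simp add: algebra_simps)
    from dvd_diff[OF 1[unfolded s] 2, unfolded this]
    show "fps_X ^ k dvd 2 * (?B\<^sup>2 * qinf ?q ?q) - 2 * pronic" .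
  qed
  then show ?thesis by simp
qed

text \<open>
  This says $\nu(q) + \nu(-q) = 2 E(q^4)^3 / E(q^2)^2$, where $E$ is the Euler product.
\<close>

theorem nu_even_part: "nu fps_X + nu (- fps_X) = 2 * dil 2 (eulersq * iphi)"
proof -
  let ?b = "qinf (- fps_X) fps_X" and ?w = "qinf fps_X (fps_X\<^sup>2)"
  let ?e = "dil 2 euler"
  have e: "?e = qinf (fps_X\<^sup>2) (fps_X\<^sup>2)"
    by (simp add: euler_eq_qinf dil_qinf dil_X)
  have be: "?b * euler = ?e"
    unfolding e unfolding euler_eq_qinf
    using qinf_mult_minus[of fps_X fps_X] by (simp add: mult.commute)
  have we: "euler = ?w * ?e"
    unfolding e unfolding euler_eq_qinf
    using qinf_even_odd[of fps_X fps_X] by (simp add: power2_eq_square)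
  have p: "phi = ?w\<^sup>2 * ?e" using phi_eq_qinf e by simp
  have nz: "?e \<noteq> 0" by (rule nonzero_if_nth_nonzero[of _ 0]) (simp add: dil_nth_0 euler_nth_0)
  \<comment> \<open>Euler: partitions into distinct parts and into odd parts, $(-q;q)_\infty (q;q^2)_\infty = 1$.\<close>
  have "?e * (?b * ?w) = ?b * (?w * ?e)" by (simp only: mult_ac)
  also have "\<dots> = ?e * 1" unfolding we[symmetric] be by simp
  finally have "?e * (?b * ?w) = ?e * 1" .
  then have bw: "?b * ?w = 1" using nz by simp
  have fe: "eulersq * iphi = ?b ^ 3 * euler"
  proof -
    have "e\<^sup>2 * i = b ^ 3 * U" if "p = w\<^sup>2 * e" "b * w = 1" "b * U = e" "p * i = 1"
      for e i b U p w :: "int fps"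
      using that by algebra
    from this[OF p bw be phi_iphi] show ?thesis unfolding eulersq_def .
  qed
  have "pronic = dil 2 (?b\<^sup>2 * euler)"
    by (simp add: pronic_eq_qinf dil_mult dil_power dil_qinf dil_uminus dil_X e)
  moreover have "qinf (fps_X\<^sup>2) (fps_X ^ 4) = dil 2 ?w"
    by (simp add: dil_qinf dil_X dil_power flip: power_mult)
  ultimately have "(nu fps_X + nu (- fps_X)) * dil 2 ?w = 2 * dil 2 (?b\<^sup>2 * euler)"
    using nu_sum_times by simp
  moreover have "dil 2 ?b * dil 2 ?w = 1" using bw by (simp add: dil_one flip: dil_mult)
  moreover have "N = 2 * (B * P)" if "N * W = 2 * P" "B * W = 1" for N W P B :: "int fps"
    using that by algebra
  ultimately have "nu fps_X + nu (- fps_X) = 2 * (dil 2 ?b * dil 2 (?b\<^sup>2 * euler))"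
    by blast
  also have "dil 2 ?b * dil 2 (?b\<^sup>2 * euler) = dil 2 (eulersq * iphi)"
    unfolding fe by (simp add: power2_eq_square power3_eq_cube mult.assoc flip: dil_mult)
  finally show ?thesis .
qed

text \<open>
  The substitution of $-q$ for $q$.
\<close>

definition flip :: "int fps \<Rightarrow> int fps" where "flip F = fps_compose F (- fps_X)"

lemma flip_nth: "fps_nth (flip F) n = (- 1) ^ n * fps_nth F n"
proof -
  have "- fps_X = fps_const (- 1 :: int) * fps_X" by (simp flip: fps_const_neg)
  then show ?thesis unfolding flip_def by (simp only: fps_nth_compose_linear)
qed

lemma flip_mult: "flip (F * G) = flip F * flip G"
  by (simp add: flip_def fps_compose_mult_distrib)

lemma flip_podd: "flip (podd n) = modd n"
  by (induction n)
     (simp_all add: flip_def podd_Suc modd_Suc fps_compose_mult_distrib fps_compose_sub_distrib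
       fps_X_power_compose)

lemma flip_rpodd: "flip (rpodd n) = rmodd n"
proof -
  have "modd n * flip (rpodd n) = flip (podd n * rpodd n)"
    by (simp add: flip_mult flip_podd)
  also have "\<dots> = 1" unfolding podd_rpodd by (simp add: flip_def)
  finally show ?thesis using modd_rmodd[of n] by algebra
qed

lemma flip_nu: "nu fps_X = flip (nu (- fps_X))"
proof (rule fps_ext)
  fix k
  have "fps_X ^ (n * (n + 1)) * rmodd (n + 1) = flip (fps_X ^ (n * (n + 1)) * rpodd (n + 1))" for n
    unfolding flip_mult flip_rpodd by (simp add: flip_def fps_X_power_compose)
  then show "fps_nth (nu fps_X) k = fps_nth (flip (nu (- fps_X))) k"
    unfolding nu_eq_fsum by (simp add: fsum_def flip_nth sum_distrib_left)
qed

lemma p_nu_even: "p_nu (2 * n) = fps_nth (eulersq * iphi) n"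
proof -
  have "2 * p_nu (2 * n) = fps_nth (nu fps_X + nu (- fps_X)) (2 * n)"
    unfolding flip_nu by (simp add: flip_nth p_nu_def)
  also have "\<dots> = 2 * fps_nth (eulersq * iphi) n"
    unfolding nu_even_part by (simp add: dil_nth numeral_fps_const)
  finally show ?thesis by simp
qed

theorem corollary1p2:
  fixes n :: nat
  shows "[p_nu (6250 * n + 5208) = 0] (mod 125)"
proof -
  have "6250 * n + 5208 = 2 * (3125 * n + 2604)" by simp
  then show ?thesis
    using eulersq_iphi_coeff[of n] by (simp only: p_nu_even cong_0_iff)
qed

end
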